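(* Let $q\ge 2$ be an integer and $U$ a $q$-step kernel such that vertices in different parts of $U$ have different degrees. If $U'$ is a kernel such that $t(H,U')=t(H,U)$ for every graph $H$ with at most $2q+1$ vertices, then $U$ and $U'$ are weakly isomorphic.
   Context: Graphs are finite and simple. A kernel is a bounded measurable symmetric function $U:[0,1]^2\to\mathbb{R}$. For a graph $H$, $t(H,U)=\int_{[0,1]^{V(H)}}\prod_{uv\in E(H)}U(x_u,x_v)\,\mathrm{d}x_{V(H)}$. Kernels $U_1,U_2$ are weakly isomorphic if $t(H,U_1)=t(H,U_2)$ for every graph $H$. A $q$-step kernel is a kernel $U$ for which $[0,1]$ can be partitioned into $q$ measurable sets of positive measure $A_1,\ldots,A_q$ (the parts) such that $U$ is constant on each $A_i\times A_j$, but no such partition into $q-1$ sets exists. The degree of a vertex $x\in[0,1]$ in $U$ is $\int_0^1U(x,y)\,\mathrm{d}y$; in a step kernel all vertices of a part have the same degree. *)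

theory Defs
  imports "HOL-Analysis.Analysis"
begin

text \<open>Kernels are curried functions of which only the values on the unit square matter.
  Measurability is Lebesgue measurability, so integrals over \<open>[0,1]\<^sup>V\<close> below are
  taken with respect to the completed product measure.\<close>

definition real_kernel :: "(real \<Rightarrow> real \<Rightarrow> real) \<Rightarrow> bool" where
  "real_kernel U \<longleftrightarrow>
     (\<lambda>(x, y). U x y) \<in> borel_measurable (lebesgue_on ({0..1} \<times> {0..1})) \<and>
     bounded ((\<lambda>(x, y). U x y) ` ({0..1} \<times> {0..1})) \<and>
     (\<forall>x\<in>{0..1}. \<forall>y\<in>{0..1}. U x y = U y x)"

text \<open>Finite simple graphs, up to isomorphism, are represented with natural numbers as vertices.\<close>

definition simple_graph :: "nat set \<Rightarrow> nat set set \<Rightarrow> bool" where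
  "simple_graph V E \<longleftrightarrow> finite V \<and> (\<forall>e\<in>E. e \<subseteq> V \<and> card e = 2)"

text \<open>The end vertices of an edge \<open>e\<close> are \<open>Min e\<close> and \<open>Max e\<close>; their order is
  irrelevant because kernels are symmetric.\<close>

definition hom_density :: "nat set \<Rightarrow> nat set set \<Rightarrow> (real \<Rightarrow> real \<Rightarrow> real) \<Rightarrow> real" where
  "hom_density V E U =
     (\<integral>x. (\<Prod>e\<in>E. U (x (Min e)) (x (Max e)))
        \<partial>completion (\<Pi>\<^sub>M v\<in>V. restrict_space lborel {0..1}))"

definition weakly_isomorphic :: "(real \<Rightarrow> real \<Rightarrow> real) \<Rightarrow> (real \<Rightarrow> real \<Rightarrow> real) \<Rightarrow> bool" where
  "weakly_isomorphic U U' \<longleftrightarrow>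
     (\<forall>V E. simple_graph V E \<longrightarrow> hom_density V E U = hom_density V E U')"

definition step_partition :: "(real \<Rightarrow> real \<Rightarrow> real) \<Rightarrow> real set set \<Rightarrow> bool" where
  "step_partition U P \<longleftrightarrow>
     finite P \<and> partition_on {0..1} P \<and>
     (\<forall>A\<in>P. A \<in> sets lebesgue \<and> measure lebesgue A > 0) \<and>
     (\<forall>A\<in>P. \<forall>B\<in>P. \<exists>c. \<forall>x\<in>A. \<forall>y\<in>B. U x y = c)"

text \<open>For a \<open>q\<close>-step kernel, the step partition into \<open>q\<close> parts is unique: two distinct parts
  with equal rows in \<open>U\<close> could be merged.\<close>

definition step_kernel :: "nat \<Rightarrow> (real \<Rightarrow> real \<Rightarrow> real) \<Rightarrow> bool" where
  "step_kernel q U \<longleftrightarrow>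
     real_kernel U \<and>
     (\<exists>P. step_partition U P \<and> card P = q) \<and>
     \<not> (\<exists>P. step_partition U P \<and> card P = q - 1)"

definition vertex_degree :: "(real \<Rightarrow> real \<Rightarrow> real) \<Rightarrow> real \<Rightarrow> real" where
  "vertex_degree U x = (\<integral>y. U x y \<partial>lebesgue_on {0..1})"

end

theory Submission
  imports Defs "HOL-Probability.Infinite_Product_Measure" "HOL-Computational_Algebra.Polynomial"
begin

text \<open>Stars determine the moments of the degree up to order \<open>2 * q\<close>. The polynomial
  \<open>\<Prod>\<^sub>i (t - d\<^sub>i)\<^sup>2\<close> over the degrees \<open>d\<^sub>i\<close> of \<open>U\<close> has exactly this order, so the degrees of \<open>U'\<close>
  are almost surely among the \<open>d\<^sub>i\<close>, with the same distribution. Lagrange polynomials of order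
  \<open>q - 1\<close> in the degree are then indicator functions of the parts. Pendant edges at a vertex
  multiply the integrand by a power of its degree, so an edge with leaves at both ends and a path on
  three vertices with leaves at both ends (at most \<open>2 * q + 1\<close> vertices) show that the span of these
  indicator functions is invariant under the integral operator of \<open>U'\<close>, with the same matrix as for
  \<open>U\<close>. The density of the 4-cycle is the trace of the fourth power of the operator; hence the
  operator vanishes on the orthogonal complement and \<open>U'\<close> is almost everywhere the same step
  function of the degrees as \<open>U\<close>.\<close>

section \<open>Bounded measurable functions and their integrals\<close>

text \<open>The bound holds at every point rather than almost everywhere, so that sections of a
  bounded function of two variables stay bounded and, for a finite measure, every function of this
  class is integrable.\<close>

definition bmeas :: "'a measure \<Rightarrow> ('a \<Rightarrow> real) \<Rightarrow> bool" where
  "bmeas M f \<longleftrightarrow> f \<in> borel_measurable M \<and> (\<exists>B. \<forall>x. \<bar>f x\<bar> \<le> B)"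

lemma bmeasD [measurable_dest]: "bmeas M f \<Longrightarrow> f \<in> borel_measurable M"
  by (simp add: bmeas_def)

lemma bmeasE:
  assumes "bmeas M f"
  obtains B where "B \<ge> 0" "\<And>x. \<bar>f x\<bar> \<le> B"
  using assms unfolding bmeas_def by (meson abs_ge_zero order_trans)

lemma bmeas_const: "bmeas M (\<lambda>x. c)"
  by (auto simp: bmeas_def)

lemma bmeas_add:
  assumes f: "bmeas M f" and g: "bmeas M g"
  shows "bmeas M (\<lambda>x. f x + g x)"
proof -
  obtain B C where "\<And>x. \<bar>f x\<bar> \<le> B" "\<And>x. \<bar>g x\<bar> \<le> C"
    using f g by (metis bmeasE)
  then have "\<bar>f x + g x\<bar> \<le> B + C" for x
    by (meson abs_triangle_ineq add_mono order_trans)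
  then show ?thesis
    using f g by (auto simp: bmeas_def)
qed

lemma bmeas_mult:
  assumes f: "bmeas M f" and g: "bmeas M g"
  shows "bmeas M (\<lambda>x. f x * g x)"
proof -
  obtain B C where "\<And>x. \<bar>f x\<bar> \<le> B" "\<And>x. \<bar>g x\<bar> \<le> C"
    using f g by (metis bmeasE)
  then have "\<bar>f x * g x\<bar> \<le> B * C" for x
    unfolding abs_mult by (intro mult_mono) (auto intro: order_trans[OF abs_ge_zero])
  then show ?thesis
    using f g by (auto simp: bmeas_def)
qed

lemma bmeas_diff: "bmeas M f \<Longrightarrow> bmeas M g \<Longrightarrow> bmeas M (\<lambda>x. f x - g x)"
  using bmeas_add[of M f "\<lambda>x. -1 * g x"] bmeas_mult[OF bmeas_const, of M g "-1"] by simp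

lemma bmeas_power: "bmeas M f \<Longrightarrow> bmeas M (\<lambda>x. f x ^ n)"
  by (induction n) (simp_all add: bmeas_const bmeas_mult)

lemma bmeas_sum: "(\<And>i. i \<in> I \<Longrightarrow> bmeas M (f i)) \<Longrightarrow> bmeas M (\<lambda>x. \<Sum>i\<in>I. f i x)"
  by (induction I rule: infinite_finite_induct) (simp_all add: bmeas_const bmeas_add)

lemma bmeas_prod: "(\<And>i. i \<in> I \<Longrightarrow> bmeas M (f i)) \<Longrightarrow> bmeas M (\<lambda>x. \<Prod>i\<in>I. f i x)"
  by (induction I rule: infinite_finite_induct) (simp_all add: bmeas_const bmeas_mult)

lemma bmeas_poly: "bmeas M f \<Longrightarrow> bmeas M (\<lambda>x. poly p (f x))"
  by (induction p) (simp_all add: bmeas_const bmeas_mult bmeas_add)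

lemma bmeas_comp:
  assumes "bmeas M f" "g \<in> measurable N M"
  shows "bmeas N (\<lambda>x. f (g x))"
  using assms by (auto simp: bmeas_def)

lemma (in finite_measure) integrable_bmeas: "bmeas M f \<Longrightarrow> integrable M f"
  by (rule bmeasE, assumption, rule integrable_const_bound) (auto simp: bmeas_def)

lemma (in prob_space) bmeas_integral:
  assumes "bmeas (N \<Otimes>\<^sub>M M) (\<lambda>q. F (fst q) (snd q))"
  shows "bmeas N (\<lambda>p. \<integral>z. F p z \<partial>M)"
proof -
  obtain B where B: "B \<ge> 0" "\<And>q. \<bar>F (fst q) (snd q)\<bar> \<le> B"
    using bmeasE[OF assms] by metis
  have "\<bar>\<integral>z. F p z \<partial>M\<bar> \<le> B" for p
  proof (cases "integrable M (F p)")
    case True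
    have "\<bar>\<integral>z. F p z \<partial>M\<bar> \<le> (\<integral>z. \<bar>F p z\<bar> \<partial>M)"
      by simp
    also have "\<dots> \<le> (\<integral>z. B \<partial>M)"
      using True B(2)[of "(p, _)"] by (intro integral_mono) auto
    finally show ?thesis
      by (simp add: prob_space)
  \<comment> \<open>For \<open>p\<close> outside the space of \<open>N\<close> the section need not
    be integrable. Its integral is then 0 by convention, and the bound survives because
    \<open>B\<close> is nonnegative.\<close>
  qed (use B in \<open>simp add: not_integrable_integral_eq\<close>)
  moreover have [measurable]: "(\<lambda>q. F (fst q) (snd q)) \<in> borel_measurable (N \<Otimes>\<^sub>M M)"
    using assms by (rule bmeasD)
  have "(\<lambda>p. \<integral>z. F p z \<partial>M) \<in> borel_measurable N"
    by (rule borel_measurable_lebesgue_integral) (simp add: case_prod_beta')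
  ultimately show ?thesis
    by (auto simp: bmeas_def)
qed

lemmas bmeas_intros = bmeas_const bmeas_add bmeas_mult bmeas_diff bmeas_power bmeas_sum bmeas_prod
  bmeas_poly

lemma (in prob_space) bmeas_Fubini:
  assumes "bmeas (M \<Otimes>\<^sub>M M) (\<lambda>q. F (fst q) (snd q))"
  shows "(\<integral>x. \<integral>y. F x y \<partial>M \<partial>M) = (\<integral>y. \<integral>x. F x y \<partial>M \<partial>M)"
proof -
  interpret P: pair_prob_space M M ..
  from P.integrable_bmeas[OF assms] show ?thesis
    by (intro P.Fubini_integral[symmetric]) (simp add: case_prod_beta')
qed

section \<open>Bounded symmetric kernels, and kernels whose square vanishes\<close>

text \<open>Symmetry is required at every point, so that arguments can be exchanged under an
  integral without exceptional null sets. \<open>real_kernel_ex_bkernel\<close> supplies such a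
  representative for a kernel on the unit square.\<close>

definition bkernel :: "'a measure \<Rightarrow> ('a \<Rightarrow> 'a \<Rightarrow> real) \<Rightarrow> bool" where
  "bkernel M W \<longleftrightarrow> bmeas (M \<Otimes>\<^sub>M M) (\<lambda>q. W (fst q) (snd q)) \<and> (\<forall>x y. W x y = W y x)"

lemma bkernel_sym: "bkernel M W \<Longrightarrow> W x y = W y x"
  unfolding bkernel_def by blast

lemma bkernel_bmeas:
  assumes "bkernel M W" and [measurable]: "f \<in> measurable N M" "g \<in> measurable N M"
  shows "bmeas N (\<lambda>p. W (f p) (g p))"
proof -
  have "bmeas (M \<Otimes>\<^sub>M M) (\<lambda>q. W (fst q) (snd q))"
    using assms(1) by (simp add: bkernel_def)
  from bmeas_comp[OF this, of "\<lambda>p. (f p, g p)" N] show ?thesis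
    by simp
qed

text \<open>With the whole type as underlying space, all sections of a kernel are measurable without
  membership side conditions.\<close>

locale full_prob_space = prob_space +
  assumes space_UNIV [simp]: "space M = UNIV"
begin

text \<open>Let \<open>T\<close> be the integral operator of \<open>V\<close>. The second hypothesis
  says that the kernel \<open>V2\<close> of its square has L2 norm 0. As \<open>T\<close> is
  self-adjoint, the squared norm of \<open>T f\<close> is the inner product of \<open>f\<close> with
  the square of \<open>T\<close> applied to \<open>f\<close>, hence 0 for every bounded measurable
  \<open>f\<close>. With indicator functions for \<open>f\<close>, the integral of \<open>V\<close>
  over every rectangle vanishes, and then over every measurable set of pairs.\<close>

lemma kernel_zero:
  assumes V: "bkernel M V"
    and zero: "(\<integral>x. \<integral>y. (\<integral>z. V x z * V z y \<partial>M)\<^sup>2 \<partial>M \<partial>M) = 0"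
  shows "AE p in M \<Otimes>\<^sub>M M. V (fst p) (snd p) = 0"
proof -
  interpret P: pair_prob_space M M ..
  note I = bmeas_intros bmeas_integral bkernel_bmeas[OF V]
  define V2 where "V2 x y = (\<integral>z. V x z * V z y \<partial>M)" for x y
  have V2: "bmeas N (\<lambda>p. V2 (f p) (g p))" if [measurable]: "f \<in> measurable N M" "g \<in> measurable N M" for f g and N :: "'c measure"
    unfolding V2_def by (intro I; measurable)
  have V2': "bmeas M (V2 x)" for x
    by (rule V2) simp_all
  have ae0: "AE x in M. AE y in M. V2 x y = 0"
  proof -
    have "AE x in M. (\<integral>y. (V2 x y)\<^sup>2 \<partial>M) = 0"
      using zero unfolding V2_def[symmetric]
      by (subst (asm) integral_nonneg_eq_0_iff_AE) (auto intro!: integrable_bmeas I V2 V2')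
    then show ?thesis
    proof eventually_elim
      case (elim x)
      then show ?case
        by (subst (asm) integral_nonneg_eq_0_iff_AE) (auto intro!: integrable_bmeas I V2 V2')
    qed
  qed
  have T0: "AE z in M. (\<integral>x. V z x * f x \<partial>M) = 0" if f: "bmeas M f" for f
  proof -
    note J = I bmeas_comp[OF f]
    have "(\<integral>z. (\<integral>x. V z x * f x \<partial>M)\<^sup>2 \<partial>M) = (\<integral>z. \<integral>x. \<integral>y. V z x * f x * (V z y * f y) \<partial>M \<partial>M \<partial>M)"
      by (simp add: power2_eq_square)
    also have "\<dots> = (\<integral>x. \<integral>z. \<integral>y. V z x * f x * (V z y * f y) \<partial>M \<partial>M \<partial>M)"
      by (intro bmeas_Fubini J; measurable)
    also have "\<dots> = (\<integral>x. \<integral>y. \<integral>z. V z x * f x * (V z y * f y) \<partial>M \<partial>M \<partial>M)"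
      by (intro Bochner_Integration.integral_cong refl bmeas_Fubini J; measurable; simp)
    also have "\<dots> = (\<integral>x. \<integral>y. f x * f y * V2 x y \<partial>M \<partial>M)"
      unfolding V2_def Bochner_Integration.integral_mult_right_zero[symmetric]
      by (intro Bochner_Integration.integral_cong refl) (simp add: bkernel_sym[OF V] mult_ac)
    also have "\<dots> = 0"
    proof -
      have "AE x in M. (\<integral>y. f x * f y * V2 x y \<partial>M) = 0"
        using ae0 by eventually_elim (auto intro!: integral_eq_zero_AE)
      then show ?thesis
        by (rule integral_eq_zero_AE)
    qed
    finally have "(\<integral>z. (\<integral>x. V z x * f x \<partial>M)\<^sup>2 \<partial>M) = 0" .
    then show ?thesis
      by (subst (asm) integral_nonneg_eq_0_iff_AE) (auto intro!: integrable_bmeas J)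
  qed
  \<comment> \<open>Rectangles are a generator closed under intersections, so it is enough that the
    sets over which \<open>V\<close> integrates to 0 are closed under complements and countable
    disjoint unions. The complement uses that the whole space is itself a rectangle.\<close>
  have null: "(LINT p:A|M \<Otimes>\<^sub>M M. V (fst p) (snd p)) = 0" if "A \<in> sets (M \<Otimes>\<^sub>M M)" for A
  proof -
    let ?G = "{a \<times> b |a b. a \<in> sets M \<and> b \<in> sets M}"
    have intV: "set_integrable (M \<Otimes>\<^sub>M M) A (\<lambda>p. V (fst p) (snd p))" if "A \<in> sets (M \<Otimes>\<^sub>M M)" for A
      unfolding set_integrable_def using that
      by (intro integrable_mult_indicator P.integrable_bmeas I) auto
    have sets: "sigma_sets UNIV ?G = sets (M \<Otimes>\<^sub>M M)"
      by (simp add: sets_pair_measure)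
    have rect: "(LINT p:a \<times> b|M \<Otimes>\<^sub>M M. V (fst p) (snd p)) = 0"
      if [measurable]: "a \<in> sets M" "b \<in> sets M" for a b
    proof -
      have "(LINT p:a \<times> b|M \<Otimes>\<^sub>M M. V (fst p) (snd p)) =
          (\<integral>x. \<integral>y. indicator (a \<times> b) (x, y) * V x y \<partial>M \<partial>M)"
        unfolding set_lebesgue_integral_def using intV[of "a \<times> b"]
        by (subst P.integral_fst'[symmetric]) (auto simp: set_integrable_def)
      also have "\<dots> = (\<integral>x. indicator a x * (\<integral>y. V x y * indicator b y \<partial>M) \<partial>M)"
        by (simp add: indicator_times mult_ac flip: Bochner_Integration.integral_mult_right_zero)
      also have "\<dots> = 0"
      proof -
        have "bmeas M (indicator b)"
          by (auto simp: bmeas_def indicator_def intro!: exI[of _ 1])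
        from T0[OF this] show ?thesis
          by (intro integral_eq_zero_AE) (auto elim: eventually_mono)
      qed
      finally show ?thesis .
    qed
    from that have "A \<in> sigma_sets UNIV ?G"
      by (simp add: sets)
    with Int_stable_pair_measure_generator Pow_UNIV[THEN equalityD2, THEN subset_trans[OF subset_UNIV]] show ?thesis
    proof (induction rule: sigma_sets_induct_disjoint)
      case (compl A)
      have "(LINT p:A \<union> (UNIV - A)|M \<Otimes>\<^sub>M M. V (fst p) (snd p)) =
          (LINT p:A|M \<Otimes>\<^sub>M M. V (fst p) (snd p)) + (LINT p:UNIV - A|M \<Otimes>\<^sub>M M. V (fst p) (snd p))"
        using compl(1) sets.compl_sets[of A "M \<Otimes>\<^sub>M M"] unfolding sets
        by (intro set_integral_Un intV) (auto simp: space_pair_measure)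
      moreover have "(LINT p:A \<union> (UNIV - A)|M \<Otimes>\<^sub>M M. V (fst p) (snd p)) = 0"
        using rect[of UNIV UNIV] sets.top[of M] by simp
      ultimately show ?case
        using compl(2) by simp
    next
      case (union A)
      then show ?case
        unfolding sets
        by (subst lebesgue_integral_countable_add)
          (auto simp: disjoint_family_on_def intro!: intV sets.countable_UN)
    qed (auto simp: rect, simp add: set_lebesgue_integral_def)
  qed
  show ?thesis
    by (rule P.density_zero) (auto intro!: P.integrable_bmeas I null)
qed

end

section \<open>Step functions over a family of functions, and when a kernel must be one\<close>

text \<open>If the \<open>e a\<close> are the indicator functions of parts, this is the step kernel
  with the value \<open>f a b\<close> on part \<open>a\<close> times part \<open>b\<close>.
  Arbitrary \<open>e a\<close> are allowed because the polynomials in the degree of the second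
  kernel that are used here are identified through their inner products only.\<close>

definition step_fun :: "('i \<Rightarrow> 'i \<Rightarrow> real) \<Rightarrow> 'i set \<Rightarrow> ('i \<Rightarrow> 'a \<Rightarrow> real) \<Rightarrow> 'a \<Rightarrow> 'a \<Rightarrow> real" where
  "step_fun f D e x y = (\<Sum>a\<in>D. \<Sum>b\<in>D. f a b * (e a x * e b y))"

context full_prob_space
begin

lemma bmeas_step_fun:
  assumes e: "\<And>a. a \<in> D \<Longrightarrow> bmeas M (e a)" and [measurable]: "g \<in> measurable N M" "h \<in> measurable N M"
  shows "bmeas N (\<lambda>p. step_fun f D e (g p) (h p))"
  unfolding step_fun_def by (intro bmeas_intros bmeas_comp[OF e]; measurable)

lemma integral_step_fun_mult:
  assumes e: "\<And>a. a \<in> D \<Longrightarrow> bmeas M (e a)" and g: "bmeas M g"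
  shows "(\<integral>y. step_fun f D e x y * g y \<partial>M) = (\<Sum>a\<in>D. \<Sum>c\<in>D. f a c * e a x * (\<integral>y. e c y * g y \<partial>M))"
proof -
  have "(\<integral>y. step_fun f D e x y * g y \<partial>M) = (\<integral>y. (\<Sum>a\<in>D. \<Sum>c\<in>D. f a c * e a x * (e c y * g y)) \<partial>M)"
    unfolding step_fun_def by (simp add: sum_distrib_right sum_distrib_left mult_ac)
  also have "\<dots> = (\<Sum>a\<in>D. \<Sum>c\<in>D. f a c * e a x * (\<integral>y. e c y * g y \<partial>M))"
    using e g by (simp add: integrable_bmeas bmeas_intros)
  finally show ?thesis .
qed

lemma integral_mult_step_fun:
  assumes e: "\<And>a. a \<in> D \<Longrightarrow> bmeas M (e a)" and g: "bmeas M g"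
  shows "(\<integral>x. g x * step_fun f D e x y \<partial>M) = (\<Sum>a\<in>D. \<Sum>c\<in>D. f a c * e c y * (\<integral>x. g x * e a x \<partial>M))"
proof -
  have "(\<integral>x. g x * step_fun f D e x y \<partial>M) = (\<integral>x. (\<Sum>a\<in>D. \<Sum>c\<in>D. f a c * e c y * (g x * e a x)) \<partial>M)"
    unfolding step_fun_def by (simp add: sum_distrib_left mult_ac)
  also have "\<dots> = (\<Sum>a\<in>D. \<Sum>c\<in>D. f a c * e c y * (\<integral>x. g x * e a x \<partial>M))"
    using e g by (simp add: integrable_bmeas bmeas_intros)
  finally show ?thesis .
qed

text \<open>Composing integral operators multiplies the coefficient matrices. Since the
  \<open>e a\<close> need not be orthonormal, their Gram matrix stands between the two
  factors.\<close>

lemma integral_step_fun_compose: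
  assumes e: "\<And>a. a \<in> D \<Longrightarrow> bmeas M (e a)"
  shows "(\<integral>z. step_fun f D e x z * step_fun g D e z y \<partial>M) =
    step_fun (\<lambda>a b. \<Sum>c\<in>D. \<Sum>d\<in>D. f a c * g d b * (\<integral>z. e c z * e d z \<partial>M)) D e x y"
proof -
  have "(\<integral>z. step_fun f D e x z * step_fun g D e z y \<partial>M) =
      (\<Sum>a\<in>D. \<Sum>c\<in>D. f a c * e a x * (\<Sum>d\<in>D. \<Sum>b\<in>D. g d b * e b y * (\<integral>z. e c z * e d z \<partial>M)))"
    using e by (simp add: integral_step_fun_mult integral_mult_step_fun bmeas_step_fun)
  also have "\<dots> = (\<Sum>a\<in>D. \<Sum>c\<in>D. \<Sum>d\<in>D. \<Sum>b\<in>D. f a c * e a x * (g d b * e b y * (\<integral>z. e c z * e d z \<partial>M)))"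
    by (simp add: sum_distrib_left)
  also have "\<dots> = (\<Sum>a\<in>D. \<Sum>c\<in>D. \<Sum>b\<in>D. \<Sum>d\<in>D. f a c * e a x * (g d b * e b y * (\<integral>z. e c z * e d z \<partial>M)))"
    by (intro sum.cong refl sum.swap)
  also have "\<dots> = (\<Sum>a\<in>D. \<Sum>b\<in>D. \<Sum>c\<in>D. \<Sum>d\<in>D. f a c * e a x * (g d b * e b y * (\<integral>z. e c z * e d z \<partial>M)))"
    by (intro sum.cong refl sum.swap)
  also have "\<dots> = step_fun (\<lambda>a b. \<Sum>c\<in>D. \<Sum>d\<in>D. f a c * g d b * (\<integral>z. e c z * e d z \<partial>M)) D e x y"
    unfolding step_fun_def by (simp add: sum_distrib_left sum_distrib_right mult_ac)
  finally show ?thesis .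
qed

text \<open>What matters is that the right-hand side involves the \<open>e a\<close> only through
  their Gram matrix: two families with the same Gram matrix give step functions of the same L2
  norm.\<close>

lemma integral_step_fun_square:
  assumes e: "\<And>a. a \<in> D \<Longrightarrow> bmeas M (e a)"
  shows "(\<integral>x. \<integral>y. (step_fun g D e x y)\<^sup>2 \<partial>M \<partial>M) =
    (\<Sum>a\<in>D. \<Sum>b\<in>D. g a b * (\<Sum>c\<in>D. \<Sum>d\<in>D. g c d * (\<integral>y. e d y * e b y \<partial>M) * (\<integral>x. e c x * e a x \<partial>M)))"
proof -
  have "(\<integral>y. (step_fun g D e x y)\<^sup>2 \<partial>M) =
      (\<Sum>a\<in>D. \<Sum>b\<in>D. g a b * (\<Sum>c\<in>D. \<Sum>d\<in>D. g c d * (\<integral>y. e d y * e b y \<partial>M) * (e c x * e a x)))" for x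
  proof -
    have "(\<integral>y. (step_fun g D e x y)\<^sup>2 \<partial>M) = (\<Sum>a\<in>D. \<Sum>b\<in>D. g a b * e a x * (\<integral>y. e b y * step_fun g D e x y \<partial>M))"
      using e by (simp add: power2_eq_square integral_step_fun_mult bmeas_step_fun)
    also have "\<dots> = (\<Sum>a\<in>D. \<Sum>b\<in>D. g a b * e a x * (\<Sum>c\<in>D. \<Sum>d\<in>D. g c d * e c x * (\<integral>y. e d y * e b y \<partial>M)))"
      using e by (subst mult.commute[of "e _ _" "step_fun _ _ _ _ _"]) (simp add: integral_step_fun_mult)
    finally show ?thesis
      by (simp add: sum_distrib_left mult_ac)
  qed
  then show ?thesis
    using e by (simp add: integrable_bmeas bmeas_intros)
qed

text \<open>The squared distance of \<open>t\<close> from a linear combination is determined by the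
  norm of \<open>t\<close>, its inner products with the \<open>e a\<close>, and the Gram
  matrix.\<close>

lemma integral_diff_sum_square:
  assumes e: "\<And>a. a \<in> D \<Longrightarrow> bmeas M (e a)" and t: "bmeas M t"
  shows "(\<integral>x. (t x - (\<Sum>a\<in>D. h a * e a x))\<^sup>2 \<partial>M) =
    (\<integral>x. (t x)\<^sup>2 \<partial>M) - 2 * (\<Sum>a\<in>D. h a * (\<integral>x. e a x * t x \<partial>M)) +
    (\<Sum>a\<in>D. \<Sum>b\<in>D. h a * h b * (\<integral>x. e a x * e b x \<partial>M))"
proof -
  have "(\<integral>x. (t x - (\<Sum>a\<in>D. h a * e a x))\<^sup>2 \<partial>M) =
     (\<integral>x. (t x)\<^sup>2 - 2 * (\<Sum>a\<in>D. h a * (e a x * t x)) + (\<Sum>a\<in>D. \<Sum>b\<in>D. h a * h b * (e a x * e b x)) \<partial>M)"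
    by (intro Bochner_Integration.integral_cong refl)
      (simp add: power2_eq_square algebra_simps sum_distrib_left sum_distrib_right)
  then show ?thesis
    using e t by (simp add: integrable_bmeas bmeas_intros)
qed

text \<open>Invariance of the span of the \<open>e' a\<close> holds because the squared distance of \<open>W' (e' b)\<close> from
  its candidate value expands into the quantities in \<open>gram\<close>, \<open>op\<close> and \<open>op2\<close>.\<close>

lemma kernel_eq_step_fun:
  assumes fin: "finite D" and f_sym: "\<And>a b. f a b = f b a"
    and W: "bkernel M W" and W': "bkernel M W'"
    and e: "\<And>a. a \<in> D \<Longrightarrow> bmeas M (e a)" and e': "\<And>a. a \<in> D \<Longrightarrow> bmeas M (e' a)"
    and W_eq: "AE x in M. AE y in M. W x y = step_fun f D e x y"
    and gram: "\<And>a b. a \<in> D \<Longrightarrow> b \<in> D \<Longrightarrow> (\<integral>x. e' a x * e' b x \<partial>M) = (\<integral>x. e a x * e b x \<partial>M)"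
    and op: "\<And>a b. a \<in> D \<Longrightarrow> b \<in> D \<Longrightarrow>
      (\<integral>x. e' a x * (\<integral>y. W' x y * e' b y \<partial>M) \<partial>M) = (\<integral>x. e a x * (\<integral>y. W x y * e b y \<partial>M) \<partial>M)"
    and op2: "\<And>b. b \<in> D \<Longrightarrow>
      (\<integral>x. (\<integral>y. W' x y * e' b y \<partial>M)\<^sup>2 \<partial>M) = (\<integral>x. (\<integral>y. W x y * e b y \<partial>M)\<^sup>2 \<partial>M)"
    and C4: "(\<integral>x. \<integral>y. (\<integral>z. W' x z * W' z y \<partial>M)\<^sup>2 \<partial>M \<partial>M) = (\<integral>x. \<integral>y. (\<integral>z. W x z * W z y \<partial>M)\<^sup>2 \<partial>M \<partial>M)"
  shows "AE p in M \<Otimes>\<^sub>M M. W' (fst p) (snd p) = step_fun f D e' (fst p) (snd p)"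
proof -
  define S where "S = step_fun f D e"
  define S' where "S' = step_fun f D e'"
  \<comment> \<open>The remainder of \<open>W'\<close> beside its expected step part. It is shown to
    annihilate every \<open>e' b\<close>, and then its square is shown to vanish almost
    everywhere.\<close>
  define V where "V x y = W' x y - S' x y" for x y
  have sym: "step_fun f D e x y = step_fun f D e y x" for e :: "_ \<Rightarrow> 'a \<Rightarrow> real" and x y
    unfolding step_fun_def by (subst sum.swap) (simp add: f_sym mult_ac)
  have S: "bkernel M S" and S': "bkernel M S'"
    using e e' unfolding bkernel_def S_def S'_def by (auto intro: bmeas_step_fun sym)
  note I = bmeas_intros bmeas_integral bkernel_bmeas[OF W] bkernel_bmeas[OF W'] bkernel_bmeas[OF S]
     bkernel_bmeas[OF S'] bmeas_comp[OF e] bmeas_comp[OF e']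
  have V: "bkernel M V"
    unfolding bkernel_def V_def using bkernel_sym[OF W'] bkernel_sym[OF S'] by (auto intro!: I)
  have W_S: "AE x in M. AE y in M. W x y = S x y"
    using W_eq by (simp add: S_def)
  have S_op: "(\<integral>y. S x y * e b y \<partial>M) = (\<Sum>a\<in>D. (\<Sum>c\<in>D. f a c * (\<integral>y. e c y * e b y \<partial>M)) * e a x)"
    and S'_op: "(\<integral>y. S' x y * e' b y \<partial>M) = (\<Sum>a\<in>D. (\<Sum>c\<in>D. f a c * (\<integral>y. e c y * e b y \<partial>M)) * e' a x)"
    if "b \<in> D" for b x
    using e e' that unfolding S_def S'_def
    by (simp_all add: integral_step_fun_mult sum_distrib_right gram) (simp_all add: mult_ac)
  have V_op: "AE x in M. (\<integral>y. V x y * e' b y \<partial>M) = 0" if b: "b \<in> D" for b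
  proof -
    define h where "h a = (\<Sum>c\<in>D. f a c * (\<integral>y. e c y * e b y \<partial>M))" for a
    have Te: "bmeas M (\<lambda>x. \<integral>y. W x y * e b y \<partial>M)" and Te': "bmeas M (\<lambda>x. \<integral>y. W' x y * e' b y \<partial>M)"
      using b by (intro I; measurable)+
    have "(\<integral>x. ((\<integral>y. W' x y * e' b y \<partial>M) - (\<Sum>a\<in>D. h a * e' a x))\<^sup>2 \<partial>M) =
        (\<integral>x. ((\<integral>y. W x y * e b y \<partial>M) - (\<Sum>a\<in>D. h a * e a x))\<^sup>2 \<partial>M)"
      using e e' Te Te' b by (simp add: integral_diff_sum_square op2 op gram)
    \<comment> \<open>For \<open>W\<close> the distance is 0, because \<open>W\<close> is almost
      everywhere \<open>S\<close>, and \<open>S\<close> maps \<open>e b\<close> exactly to the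
      combination with coefficients \<open>h\<close>.\<close>
    also have "\<dots> = 0"
    proof -
      have "AE x in M. (\<integral>y. W x y * e b y \<partial>M) = (\<integral>y. S x y * e b y \<partial>M)"
        using W_S by eventually_elim
          (rule integral_cong_AE; (auto)?; intro bmeasD I b; measurable)
      then show ?thesis
        using b by (intro integral_eq_zero_AE) (auto simp: S_op h_def elim: eventually_mono)
    qed
    finally have "(\<integral>x. ((\<integral>y. W' x y * e' b y \<partial>M) - (\<integral>y. S' x y * e' b y \<partial>M))\<^sup>2 \<partial>M) = 0"
      using b by (simp add: S'_op h_def)
    moreover have "(\<integral>y. W' x y * e' b y \<partial>M) - (\<integral>y. S' x y * e' b y \<partial>M) = (\<integral>y. V x y * e' b y \<partial>M)" for x
      unfolding V_def left_diff_distrib using b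
      by (intro Bochner_Integration.integral_diff[symmetric] integrable_bmeas I; measurable)
    ultimately have "(\<integral>x. (\<integral>y. V x y * e' b y \<partial>M)\<^sup>2 \<partial>M) = 0"
      by simp
    then show ?thesis
      using b by (subst (asm) integral_nonneg_eq_0_iff_AE) (auto intro!: integrable_bmeas I bkernel_bmeas[OF V])
  qed
  note J = I bkernel_bmeas[OF V]
  define V2 where "V2 x y = (\<integral>z. V x z * V z y \<partial>M)" for x y
  define g where "g a b = (\<Sum>c\<in>D. \<Sum>d\<in>D. f a c * f d b * (\<integral>z. e c z * e d z \<partial>M))" for a b
  have V2: "bmeas N (\<lambda>p. V2 (k p) (l p))" if [measurable]: "k \<in> measurable N M" "l \<in> measurable N M"
    for k l and N :: "'c measure"
    unfolding V2_def by (intro J; measurable)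
  have S2: "(\<integral>z. S x z * S z y \<partial>M) = step_fun g D e x y" for x y
    unfolding S_def g_def using e by (simp add: integral_step_fun_compose)
  have S2': "(\<integral>z. S' x z * S' z y \<partial>M) = step_fun g D e' x y" for x y
    unfolding S'_def step_fun_def g_def using e'
    by (simp add: integral_step_fun_compose[unfolded step_fun_def] gram)
  note K = J V2 bmeas_step_fun[OF e, where f = g and D = D] bmeas_step_fun[OF e', where f = g and D = D]
  \<comment> \<open>In the square of \<open>W' = S' + V\<close> both mixed terms vanish: each
    section of \<open>S'\<close> is a combination of the \<open>e' b\<close>, which \<open>V\<close>
    annihilates. By symmetry the second mixed term is the first one with \<open>x\<close> and
    \<open>y\<close> exchanged.\<close>
  have W2': "AE x in M. AE y in M. (\<integral>z. W' x z * W' z y \<partial>M) = step_fun g D e' x y + V2 x y"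
  proof -
    have ae: "AE x in M. \<forall>b\<in>D. (\<integral>y. V x y * e' b y \<partial>M) = 0"
      using V_op by (intro AE_finite_allI fin)
    have VS: "(\<integral>z. V x z * S' z y \<partial>M) = 0" if "\<forall>b\<in>D. (\<integral>y. V x y * e' b y \<partial>M) = 0" for x y
      unfolding S'_def using that e' by (subst integral_mult_step_fun) (auto intro!: J)
    show ?thesis
      using ae
    proof eventually_elim
      case (elim x)
      note x = VS[OF elim]
      show ?case
        using ae
      proof eventually_elim
        case (elim y)
        have "(\<integral>z. W' x z * W' z y \<partial>M) =
            (\<integral>z. S' x z * S' z y + V x z * S' z y + V y z * S' z x + V x z * V z y \<partial>M)"
          by (intro Bochner_Integration.integral_cong refl)
            (simp add: V_def bkernel_sym[OF W', of y] bkernel_sym[OF S', of y] bkernel_sym[OF S', of _ x] algebra_simps)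
        also have "\<dots> = (\<integral>z. S' x z * S' z y \<partial>M) + (\<integral>z. V x z * S' z y \<partial>M) + (\<integral>z. V y z * S' z x \<partial>M) + V2 x y"
          unfolding V2_def by (simp add: integrable_bmeas J)
        finally show ?case
          using x VS[OF elim] by (simp add: S2')
      qed
    qed
  qed
  \<comment> \<open>Every \<open>e' b\<close> is orthogonal to the sections of \<open>V2\<close>:
    after exchanging the integrals, one of the two factors \<open>V\<close> acts on
    \<open>e' b\<close>.\<close>
  have SV: "(\<integral>y. step_fun g D e' x y * V2 x y \<partial>M) = 0" for x
  proof -
    have "(\<integral>y. e' b y * V2 x y \<partial>M) = 0" if b: "b \<in> D" for b
    proof -
      have "(\<integral>y. e' b y * V2 x y \<partial>M) = (\<integral>y. \<integral>z. e' b y * (V x z * V z y) \<partial>M \<partial>M)"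
        unfolding V2_def by simp
      also have "\<dots> = (\<integral>z. \<integral>y. e' b y * (V x z * V z y) \<partial>M \<partial>M)"
        using b by (intro bmeas_Fubini J; measurable; simp)
      also have "\<dots> = (\<integral>z. V x z * (\<integral>y. V z y * e' b y \<partial>M) \<partial>M)"
        by (simp add: mult_ac flip: Bochner_Integration.integral_mult_right_zero)
      also have "\<dots> = 0"
        using V_op[OF b] by (intro integral_eq_zero_AE) (auto elim: eventually_mono)
      finally show ?thesis .
    qed
    then show ?thesis
      using e' by (simp add: integral_step_fun_mult V2)
  qed
  \<comment> \<open>By this orthogonality the 4-cycle integral of \<open>W'\<close> is the sum of
    the squared norms of \<open>step_fun g D e'\<close> and of \<open>V2\<close>. The Gram matrices
    agree, so the first summand is already the 4-cycle integral of \<open>W\<close>, and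
    \<open>C4\<close> leaves 0 for \<open>V2\<close>.\<close>
  have "(\<integral>x. \<integral>y. (\<integral>z. W' x z * W' z y \<partial>M)\<^sup>2 \<partial>M \<partial>M) = (\<integral>x. \<integral>y. (step_fun g D e' x y + V2 x y)\<^sup>2 \<partial>M \<partial>M)"
  proof (rule integral_cong_AE)
    show "AE x in M. (\<integral>y. (\<integral>z. W' x z * W' z y \<partial>M)\<^sup>2 \<partial>M) = (\<integral>y. (step_fun g D e' x y + V2 x y)\<^sup>2 \<partial>M)"
      using W2'
    proof eventually_elim
      case (elim x)
      show ?case
      proof (rule integral_cong_AE)
        show "AE y in M. (\<integral>z. W' x z * W' z y \<partial>M)\<^sup>2 = (step_fun g D e' x y + V2 x y)\<^sup>2"
          using elim by eventually_elim simp
      qed (intro bmeasD K; measurable; simp)+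
    qed
  qed (intro bmeasD K; measurable)+
  also have "\<dots> = (\<integral>x. (\<integral>y. (step_fun g D e' x y)\<^sup>2 \<partial>M) + (\<integral>y. (V2 x y)\<^sup>2 \<partial>M) \<partial>M)"
  proof (intro Bochner_Integration.integral_cong refl)
    fix x
    have "(\<integral>y. (step_fun g D e' x y + V2 x y)\<^sup>2 \<partial>M) =
        (\<integral>y. (step_fun g D e' x y)\<^sup>2 + (V2 x y)\<^sup>2 + 2 * (step_fun g D e' x y * V2 x y) \<partial>M)"
      by (simp add: power2_sum mult_ac)
    also have "\<dots> = (\<integral>y. (step_fun g D e' x y)\<^sup>2 \<partial>M) + (\<integral>y. (V2 x y)\<^sup>2 \<partial>M)"
      by (simp add: integrable_bmeas K SV)
    finally show "(\<integral>y. (step_fun g D e' x y + V2 x y)\<^sup>2 \<partial>M) = \<dots>" .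
  qed
  also have "\<dots> = (\<integral>x. \<integral>y. (step_fun g D e' x y)\<^sup>2 \<partial>M \<partial>M) + (\<integral>x. \<integral>y. (V2 x y)\<^sup>2 \<partial>M \<partial>M)"
    by (intro Bochner_Integration.integral_add integrable_bmeas K; measurable)
  also have "(\<integral>x. \<integral>y. (step_fun g D e' x y)\<^sup>2 \<partial>M \<partial>M) = (\<integral>x. \<integral>y. (step_fun g D e x y)\<^sup>2 \<partial>M \<partial>M)"
    using e e' by (simp add: integral_step_fun_square gram)
  also have "\<dots> = (\<integral>x. \<integral>y. (\<integral>z. W x z * W z y \<partial>M)\<^sup>2 \<partial>M \<partial>M)"
  proof (rule integral_cong_AE)
    have W2: "AE x in M. AE y in M. step_fun g D e x y = (\<integral>z. W x z * W z y \<partial>M)"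
      using W_S
    proof eventually_elim
      case (elim x)
      note x = elim
      show ?case
        using W_S
      proof eventually_elim
        case (elim y)
        show ?case
          unfolding S2[symmetric]
        proof (rule integral_cong_AE)
          show "AE z in M. S x z * S z y = W x z * W z y"
            using x elim by eventually_elim (simp add: bkernel_sym[OF W, of _ y] bkernel_sym[OF S, of _ y])
        qed (intro bmeasD K; measurable; simp)+
      qed
    qed
    then show "AE x in M. (\<integral>y. (step_fun g D e x y)\<^sup>2 \<partial>M) = (\<integral>y. (\<integral>z. W x z * W z y \<partial>M)\<^sup>2 \<partial>M)"
    proof eventually_elim
      case (elim x)
      show ?case
      proof (rule integral_cong_AE)
        show "AE y in M. (step_fun g D e x y)\<^sup>2 = (\<integral>z. W x z * W z y \<partial>M)\<^sup>2"
          using elim by eventually_elim simp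
      qed (intro bmeasD K; measurable; simp)+
    qed
  qed (intro bmeasD K; measurable)+
  finally have "(\<integral>x. \<integral>y. (V2 x y)\<^sup>2 \<partial>M \<partial>M) = 0"
    using C4 by simp
  then have "AE p in M \<Otimes>\<^sub>M M. V (fst p) (snd p) = 0"
    unfolding V2_def by (rule kernel_zero[OF V])
  then show ?thesis
    by (simp add: V_def S'_def)
qed

end

section \<open>Graph densities, pendant edges and powers of the degree\<close>

lemma edge_ends:
  assumes "simple_graph V E" "e \<in> E"
  shows "Min e \<in> V" "Max e \<in> V"
proof -
  have "e \<subseteq> V" "card e = 2"
    using assms by (auto simp: simple_graph_def)
  then have "e \<noteq> {}" "finite e"
    by (auto simp: card_ge_0_finite)
  then show "Min e \<in> V" "Max e \<in> V"
    using \<open>e \<subseteq> V\<close> Min_in[of e] Max_in[of e] by (metis subsetD)+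
qed

lemma edge_ends_distinct:
  assumes "simple_graph V E" "e \<in> E"
  shows "Min e \<noteq> Max e"
proof -
  have "card e = 2"
    using assms by (simp add: simple_graph_def)
  then show ?thesis
    by (auto simp: card_2_iff min_def max_def split: if_splits)
qed

lemma finite_edges: "simple_graph V E \<Longrightarrow> finite E"
  by (rule finite_subset[of _ "Pow V"]) (auto simp: simple_graph_def)

context full_prob_space
begin

definition deg :: "('a \<Rightarrow> 'a \<Rightarrow> real) \<Rightarrow> 'a \<Rightarrow> real" where
  "deg W x = (\<integral>y. W x y \<partial>M)"

lemma bmeas_deg: "bkernel M W \<Longrightarrow> bmeas M (deg W)"
  unfolding deg_def by (rule bmeas_integral, erule bkernel_bmeas; measurable)

text \<open>In contrast to \<open>hom_density\<close>, the product measure is not completed here;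
  \<open>hom_density_eq_graph_density\<close> links the two.\<close>

definition graph_density :: "nat set \<Rightarrow> nat set set \<Rightarrow> ('a \<Rightarrow> 'a \<Rightarrow> real) \<Rightarrow> real" where
  "graph_density V E W = (\<integral>x. (\<Prod>e\<in>E. W (x (Min e)) (x (Max e))) \<partial>(\<Pi>\<^sub>M v\<in>V. M))"

text \<open>This is the density of the graph obtained by attaching \<open>k v\<close> pendant edges
  at each vertex \<open>v\<close>, with all the leaves already integrated out.\<close>

definition leaf_density :: "nat set \<Rightarrow> nat set set \<Rightarrow> (nat \<Rightarrow> nat) \<Rightarrow> ('a \<Rightarrow> 'a \<Rightarrow> real) \<Rightarrow> real" where
  "leaf_density V E k W =
    (\<integral>x. (\<Prod>e\<in>E. W (x (Min e)) (x (Max e))) * (\<Prod>v\<in>V. deg W (x v) ^ k v) \<partial>(\<Pi>\<^sub>M v\<in>V. M))"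

lemma bmeas_PiM_component:
  assumes "bmeas M f" "v \<in> V"
  shows "bmeas (\<Pi>\<^sub>M v\<in>V. M) (\<lambda>x. f (x v))"
  by (rule bmeas_comp[OF assms(1) measurable_component_singleton[OF assms(2)]])

lemma bkernel_PiM_components:
  assumes "bkernel M W" "u \<in> V" "v \<in> V"
  shows "bmeas (\<Pi>\<^sub>M v\<in>V. M) (\<lambda>x. W (x u) (x v))"
  by (rule bkernel_bmeas[OF assms(1) measurable_component_singleton[OF assms(2)]
        measurable_component_singleton[OF assms(3)]])

lemma integral_PiM_insert:
  assumes "finite V" "n \<notin> V" "bmeas (\<Pi>\<^sub>M v\<in>insert n V. M) f"
  shows "(\<integral>x. f x \<partial>(\<Pi>\<^sub>M v\<in>insert n V. M)) = (\<integral>x. \<integral>y. f (x(n := y)) \<partial>M \<partial>(\<Pi>\<^sub>M v\<in>V. M))"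
proof -
  interpret PP: product_prob_space "\<lambda>_. M" "insert n V" ..
  show ?thesis
    by (rule PP.product_integral_insert[OF assms(1,2) PP.integrable_bmeas[OF assms(3)]])
qed

lemma integral_PiM_singleton:
  assumes "bmeas M f"
  shows "(\<integral>x. f (x n) \<partial>(\<Pi>\<^sub>M v\<in>{n}. M)) = (\<integral>x. f x \<partial>M)"
proof -
  interpret PP: product_prob_space "\<lambda>_. M" "{n}" ..
  show ?thesis
    by (rule PP.product_integral_singleton[OF bmeasD[OF assms]])
qed

text \<open>The coordinate of \<open>n\<close> occurs only in the factor of the edge
  \<open>{v, n}\<close>, so integrating it out leaves one more factor \<open>deg W (x v)\<close>.
  The exponent 0 at \<open>n\<close> keeps the leaf from contributing a degree of its own.\<close>

lemma leaf_density_add_leaf: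
  assumes W: "bkernel M W" and G: "simple_graph V E" and v: "v \<in> V" and n: "n \<notin> V"
  shows "leaf_density (insert n V) (insert {v, n} E) (k(n := 0)) W = leaf_density V E (k(v := Suc (k v))) W"
proof -
  note ends = edge_ends[OF G] finite_edges[OF G]
  have fin: "finite V"
    using G by (simp add: simple_graph_def)
  have "{v, n} \<notin> E" "v \<noteq> n"
    using G n v by (auto simp: simple_graph_def)
  have edge: "W (x (Min {v, n})) (x (Max {v, n})) = W (x v) (x n)" for x
    by (cases "v \<le> n") (simp_all add: min_def max_def bkernel_sym[OF W])
  have degs: "(\<Prod>u\<in>insert n V. deg W (x u) ^ (k(n := 0)) u) = (\<Prod>u\<in>V. deg W (x u) ^ k u)" for x
    using fin n by simp (rule prod.cong, auto)
  have "leaf_density (insert n V) (insert {v, n} E) (k(n := 0)) W =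
      (\<integral>x. W (x v) (x n) * (\<Prod>e\<in>E. W (x (Min e)) (x (Max e))) * (\<Prod>v\<in>V. deg W (x v) ^ k v)
        \<partial>(\<Pi>\<^sub>M v\<in>insert n V. M))"
    unfolding leaf_density_def degs by (subst prod.insert) (use ends \<open>{v, n} \<notin> E\<close> in \<open>simp_all only: edge not_False_eq_True\<close>)
  also have "\<dots> = (\<integral>x. \<integral>y. W (x v) y * (\<Prod>e\<in>E. W (x (Min e)) (x (Max e))) * (\<Prod>v\<in>V. deg W (x v) ^ k v)
        \<partial>M \<partial>(\<Pi>\<^sub>M v\<in>V. M))"
  proof (subst integral_PiM_insert[OF fin n])
    show "bmeas (\<Pi>\<^sub>M v\<in>insert n V. M) (\<lambda>x. W (x v) (x n) * (\<Prod>e\<in>E. W (x (Min e)) (x (Max e))) *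
        (\<Prod>v\<in>V. deg W (x v) ^ k v))"
      using v ends by (intro bmeas_intros bkernel_PiM_components[OF W]
          bmeas_PiM_component[OF bmeas_deg[OF W]]) auto
  next
    have "(\<Prod>e\<in>E. W ((x(n := y)) (Min e)) ((x(n := y)) (Max e))) = (\<Prod>e\<in>E. W (x (Min e)) (x (Max e)))"
      for x and y :: 'a
      using ends n by (intro prod.cong refl) (metis fun_upd_other)
    moreover have "(\<Prod>u\<in>V. deg W ((x(n := y)) u) ^ k u) = (\<Prod>u\<in>V. deg W (x u) ^ k u)" for x and y :: 'a
      using n by (intro prod.cong refl) (metis fun_upd_other)
    moreover have "W ((x(n := y)) v) ((x(n := y)) n) = W (x v) y" for x and y :: 'a
      using \<open>v \<noteq> n\<close> by simp
    ultimately show "(\<integral>x. \<integral>y. W ((x(n := y)) v) ((x(n := y)) n) * (\<Prod>e\<in>E. W ((x(n := y)) (Min e)) ((x(n := y)) (Max e))) *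
        (\<Prod>u\<in>V. deg W ((x(n := y)) u) ^ k u) \<partial>M \<partial>(\<Pi>\<^sub>M v\<in>V. M)) =
        (\<integral>x. \<integral>y. W (x v) y * (\<Prod>e\<in>E. W (x (Min e)) (x (Max e))) * (\<Prod>v\<in>V. deg W (x v) ^ k v)
        \<partial>M \<partial>(\<Pi>\<^sub>M v\<in>V. M))"
      by (simp only:)
  qed
  also have "\<dots> = leaf_density V E (k(v := Suc (k v))) W"
    unfolding leaf_density_def
  proof (intro Bochner_Integration.integral_cong refl)
    fix x
    have "(\<Prod>u\<in>V. deg W (x u) ^ (k(v := Suc (k v))) u) =
        deg W (x v) ^ Suc (k v) * (\<Prod>u\<in>V - {v}. deg W (x u) ^ k u)"
      using fin v by (subst prod.remove[of V v]) (auto intro!: prod.cong)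
    also have "\<dots> = deg W (x v) * (\<Prod>u\<in>V. deg W (x u) ^ k u)"
      using fin v by (subst prod.remove[of V v "\<lambda>u. deg W (x u) ^ k u"]) auto
    finally have "(\<Prod>u\<in>V. deg W (x u) ^ (k(v := Suc (k v))) u) = (\<integral>y. W (x v) y \<partial>M) * (\<Prod>u\<in>V. deg W (x u) ^ k u)"
      unfolding deg_def[of W "x v"] .
    then show "(\<integral>y. W (x v) y * (\<Prod>e\<in>E. W (x (Min e)) (x (Max e))) * (\<Prod>v\<in>V. deg W (x v) ^ k v) \<partial>M) =
        (\<Prod>e\<in>E. W (x (Min e)) (x (Max e))) * (\<Prod>u\<in>V. deg W (x u) ^ (k(v := Suc (k v))) u)"
      by (subst (asm) eq_commute) (simp add: mult_ac)
  qed
  finally show ?thesis .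
qed

text \<open>Each induction step turns one unit of an exponent into an actual leaf. This preserves
  \<open>card V + sum k V\<close>, and once all exponents are 0 the leaf density is an ordinary
  graph density on at most \<open>m\<close> vertices.\<close>

lemma leaf_density_eq:
  assumes W: "bkernel M W" and W': "bkernel M W'"
    and eq: "\<And>V E. simple_graph V E \<Longrightarrow> card V \<le> m \<Longrightarrow> graph_density V E W' = graph_density V E W"
    and G: "simple_graph V E" "card V + sum k V \<le> m"
  shows "leaf_density V E k W' = leaf_density V E k W"
  using G
proof (induction "sum k V" arbitrary: V E k)
  case 0
  then have "finite V"
    by (simp add: simple_graph_def)
  with 0 have "\<forall>v\<in>V. k v = 0"
    by simp
  then have "leaf_density V E k U = graph_density V E U" for U
    by (simp add: leaf_density_def graph_density_def)
  with 0 eq show ?case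
    by simp
next
  case (Suc s)
  have fin: "finite V"
    using Suc.prems by (simp add: simple_graph_def)
  obtain v where v: "v \<in> V" "k v > 0"
    using Suc.hyps(2) by (metis gr0I nat.distinct(1) sum.neutral)
  obtain n where n: "n \<notin> V"
    using fin by (meson ex_new_if_finite infinite_UNIV_nat)
  define l where "l = k(v := k v - 1)"
  have k: "k = l(v := Suc (l v))"
    using v by (simp add: l_def)
  have "sum k V = Suc (sum l V)"
    using fin v by (simp add: l_def sum.remove[of V v])
  moreover have "sum (l(n := 0)) (insert n V) = sum l V"
    using fin n by simp (rule sum.cong, auto)
  moreover have "simple_graph (insert n V) (insert {v, n} E)"
    using Suc.prems(1) v n by (auto simp: simple_graph_def card_insert_if)
  ultimately have "leaf_density (insert n V) (insert {v, n} E) (l(n := 0)) W' =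
      leaf_density (insert n V) (insert {v, n} E) (l(n := 0)) W"
    using Suc fin n by (intro Suc.hyps(1)) auto
  then show ?case
    unfolding k using leaf_density_add_leaf[OF W Suc.prems(1) v(1) n] leaf_density_add_leaf[OF W' Suc.prems(1) v(1) n]
    by simp
qed

text \<open>Stars give the moments of the degree.\<close>

lemma leaf_density_vertex:
  assumes W: "bkernel M W"
  shows "leaf_density {0} {} (\<lambda>_. i) W = (\<integral>x. deg W x ^ i \<partial>M)"
  unfolding leaf_density_def using integral_PiM_singleton[of "\<lambda>x. deg W x ^ i" 0] W
  by (simp add: bmeas_intros bmeas_deg)

text \<open>In terms of the integral operator, this is the inner product of a power of the degree
  with the image of another power.\<close>

lemma leaf_density_edge:
  assumes W: "bkernel M W"
  shows "leaf_density {0, 1} {{0, 1}} ((\<lambda>_. 0)(0 := i, 1 := j)) W =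
    (\<integral>x. deg W x ^ i * (\<integral>y. W x y * deg W y ^ j \<partial>M) \<partial>M)"
proof -
  note I = bmeas_intros bkernel_PiM_components[OF W] bmeas_PiM_component[OF bmeas_deg[OF W]]
    bmeas_integral bkernel_bmeas[OF W] bmeas_comp[OF bmeas_deg[OF W]]
  have "leaf_density {0, 1} {{0, 1}} ((\<lambda>_. 0)(0 := i, 1 := j)) W =
      (\<integral>x. W (x 0) (x 1) * (deg W (x 0) ^ i * deg W (x 1) ^ j) \<partial>(\<Pi>\<^sub>M v\<in>insert 1 {0::nat}. M))"
    unfolding leaf_density_def by (simp add: insert_commute)
  also have "\<dots> = (\<integral>x. \<integral>y. W (x 0) y * (deg W (x 0) ^ i * deg W y ^ j) \<partial>M \<partial>(\<Pi>\<^sub>M v\<in>{0::nat}. M))"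
    by (subst integral_PiM_insert) (auto intro!: I)
  also have "\<dots> = (\<integral>x. \<integral>y. W x y * (deg W x ^ i * deg W y ^ j) \<partial>M \<partial>M)"
    by (rule integral_PiM_singleton) (intro I; measurable)
  finally show ?thesis
    by (simp add: mult_ac flip: Bochner_Integration.integral_mult_right_zero)
qed

text \<open>Vertex 0 is the middle of the path and the leaves hang at its ends, which gives the
  inner product of the images of two powers of the degree.\<close>

lemma leaf_density_path:
  assumes W: "bkernel M W"
  shows "leaf_density {0, 1, 2} {{0, 1}, {0, 2}} ((\<lambda>_. 0)(1 := i, 2 := j)) W =
    (\<integral>x. (\<integral>y. W x y * deg W y ^ i \<partial>M) * (\<integral>y. W x y * deg W y ^ j \<partial>M) \<partial>M)"
proof -
  note I = bmeas_intros bkernel_PiM_components[OF W] bmeas_PiM_component[OF bmeas_deg[OF W]]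
    bmeas_integral bkernel_bmeas[OF W] bmeas_comp[OF bmeas_deg[OF W]]
  have edges: "{0, 1} \<noteq> {0, 2::nat}"
    by (auto simp: doubleton_eq_iff)
  have "leaf_density {0, 1, 2} {{0, 1}, {0, 2}} ((\<lambda>_. 0)(1 := i, 2 := j)) W =
      (\<integral>x. W (x 0) (x 1) * W (x 0) (x 2) * (deg W (x 1) ^ i * deg W (x 2) ^ j)
        \<partial>(\<Pi>\<^sub>M v\<in>insert 2 (insert 1 {0::nat}). M))"
    unfolding leaf_density_def using edges by (simp add: insert_commute)
  also have "\<dots> = (\<integral>x. \<integral>z. W (x 0) (x 1) * W (x 0) z * (deg W (x 1) ^ i * deg W z ^ j)
        \<partial>M \<partial>(\<Pi>\<^sub>M v\<in>insert 1 {0::nat}. M))"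
    by (subst integral_PiM_insert) (auto intro!: I)
  also have "\<dots> = (\<integral>x. \<integral>y. \<integral>z. W (x 0) y * W (x 0) z * (deg W y ^ i * deg W z ^ j)
        \<partial>M \<partial>M \<partial>(\<Pi>\<^sub>M v\<in>{0::nat}. M))"
    by (subst integral_PiM_insert) (auto intro!: I)
  also have "\<dots> = (\<integral>x. \<integral>y. \<integral>z. W x y * W x z * (deg W y ^ i * deg W z ^ j) \<partial>M \<partial>M \<partial>M)"
    by (rule integral_PiM_singleton) (intro I; measurable)
  also have "\<dots> = (\<integral>x. \<integral>y. \<integral>z. W x y * deg W y ^ i * (W x z * deg W z ^ j) \<partial>M \<partial>M \<partial>M)"
    by (simp only: mult_ac)
  finally show ?thesis
    by simp
qed

text \<open>Vertices 0 and 1 are opposite on the cycle. Their common neighbours 2 and 3 contribute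
  the same factor, hence the square.\<close>

lemma graph_density_C4:
  assumes W: "bkernel M W"
  shows "graph_density {0, 1, 2, 3} {{0, 2}, {1, 2}, {0, 3}, {1, 3}} W =
    (\<integral>x. \<integral>y. (\<integral>z. W x z * W z y \<partial>M)\<^sup>2 \<partial>M \<partial>M)"
proof -
  note I = bmeas_intros bkernel_PiM_components[OF W] bmeas_integral bkernel_bmeas[OF W]
  have V: "{0, 1, 2, 3} = insert 3 (insert 2 (insert 1 {0::nat}))"
    by auto
  have edges: "{0, 2} \<noteq> {1, 2::nat}" "{0, 2} \<noteq> {0, 3::nat}" "{0, 2} \<noteq> {1, 3::nat}"
     "{1, 2} \<noteq> {0, 3::nat}" "{1, 2} \<noteq> {1, 3::nat}" "{0, 3} \<noteq> {1, 3::nat}"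
    by (auto simp: doubleton_eq_iff)
  have "graph_density {0, 1, 2, 3} {{0, 2}, {1, 2}, {0, 3}, {1, 3}} W =
      (\<integral>x. W (x 0) (x 2) * (W (x 1) (x 2) * (W (x 0) (x 3) * W (x 1) (x 3)))
        \<partial>(\<Pi>\<^sub>M v\<in>insert 3 (insert 2 (insert 1 {0::nat})). M))"
    unfolding graph_density_def V using edges by (simp del: One_nat_def)
  also have "\<dots> = (\<integral>x. \<integral>w. W (x 0) (x 2) * (W (x 1) (x 2) * (W (x 0) w * W (x 1) w))
        \<partial>M \<partial>(\<Pi>\<^sub>M v\<in>insert 2 (insert 1 {0::nat}). M))"
    by (subst integral_PiM_insert) (auto intro!: I)
  also have "\<dots> = (\<integral>x. \<integral>z. \<integral>w. W (x 0) z * (W (x 1) z * (W (x 0) w * W (x 1) w))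
        \<partial>M \<partial>M \<partial>(\<Pi>\<^sub>M v\<in>insert 1 {0::nat}. M))"
    by (subst integral_PiM_insert) (auto intro!: I)
  also have "\<dots> = (\<integral>x. \<integral>y. \<integral>z. \<integral>w. W (x 0) z * (W y z * (W (x 0) w * W y w))
        \<partial>M \<partial>M \<partial>M \<partial>(\<Pi>\<^sub>M v\<in>{0::nat}. M))"
    by (subst integral_PiM_insert) (auto intro!: I)
  also have "\<dots> = (\<integral>x. \<integral>y. \<integral>z. \<integral>w. W x z * (W y z * (W x w * W y w)) \<partial>M \<partial>M \<partial>M \<partial>M)"
    by (rule integral_PiM_singleton) (intro I; measurable)
  also have "\<dots> = (\<integral>x. \<integral>y. \<integral>z. \<integral>w. (W x z * W z y) * (W x w * W w y) \<partial>M \<partial>M \<partial>M \<partial>M)"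
  proof -
    have "W x z * (W y z * (W x w * W y w)) = (W x z * W z y) * (W x w * W w y)" for x y z w
      using bkernel_sym[OF W, of z y] bkernel_sym[OF W, of w y] by simp
    then show ?thesis
      by (simp only:)
  qed
  finally show ?thesis
    by (simp add: power2_eq_square)
qed

end

section \<open>Lagrange polynomials on a finite set of degrees\<close>

definition lagrange :: "real set \<Rightarrow> real \<Rightarrow> real poly" where
  "lagrange D a = (\<Prod>c\<in>D - {a}. smult (1 / (a - c)) [:- c, 1:])"

lemma degree_lagrange:
  assumes "finite D" "a \<in> D"
  shows "degree (lagrange D a) < card D"
proof -
  have "degree (lagrange D a) \<le> (\<Sum>c\<in>D - {a}. degree (smult (1 / (a - c)) [:- c, 1:]))"
    unfolding lagrange_def using degree_prod_sum_le[of "D - {a}" "\<lambda>c. smult (1 / (a - c)) [:- c, 1:]"] assms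
    by (simp add: comp_def)
  also have "\<dots> \<le> (\<Sum>c\<in>D - {a}. 1)"
    by (intro sum_mono) (auto intro: order_trans[OF degree_smult_le])
  also have "\<dots> < card D"
    using card_Diff1_less[OF assms] by simp
  finally show ?thesis .
qed

lemma poly_lagrange:
  assumes "finite D" "a \<in> D" "t \<in> D"
  shows "poly (lagrange D a) t = (if t = a then 1 else 0)"
proof (cases "t = a")
  case True
  have "poly (smult (1 / (a - c)) [:- c, 1:]) a = 1" if "c \<noteq> a" for c
    using that by (simp add: divide_simps)
  with True show ?thesis
    by (simp add: lagrange_def poly_prod del: poly_smult)
next
  case False
  with assms show ?thesis
    by (auto simp: lagrange_def poly_prod intro!: prod_zero)
qed

section \<open>From graphs on few vertices to all graphs\<close>

text \<open>Two distinct coordinates are independent: projecting to them carries the product measure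
  to the measure on pairs, so null sets of pairs pull back to null sets. It is applied to the two
  ends of an edge.\<close>

lemma (in prob_space) AE_PiM_pair:
  assumes uv: "u \<in> V" "v \<in> V" "u \<noteq> v" and P: "AE p in M \<Otimes>\<^sub>M M. P p"
  shows "AE x in (\<Pi>\<^sub>M v\<in>V. M). P (x u, x v)"
proof -
  interpret PP: product_prob_space "\<lambda>_. M" V ..
  have [measurable]: "(\<lambda>x. (x u, x v)) \<in> measurable (\<Pi>\<^sub>M v\<in>V. M) (M \<Otimes>\<^sub>M M)"
    using uv by (intro measurable_Pair measurable_component_singleton)
  have eq: "M \<Otimes>\<^sub>M M = distr (\<Pi>\<^sub>M v\<in>V. M) (M \<Otimes>\<^sub>M M) (\<lambda>x. (x u, x v))"
  proof (rule pair_measure_eqI)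
    fix A B assume AB [measurable]: "A \<in> sets M" "B \<in> sets M"
    have "emeasure (distr (\<Pi>\<^sub>M v\<in>V. M) (M \<Otimes>\<^sub>M M) (\<lambda>x. (x u, x v))) (A \<times> B) =
        emeasure (\<Pi>\<^sub>M v\<in>V. M) {x \<in> space (\<Pi>\<^sub>M v\<in>V. M). \<forall>i\<in>{u, v}. x i \<in> (if i = u then A else B)}"
      using uv by (subst emeasure_distr) (auto intro!: arg_cong[where f = "emeasure _"])
    also have "\<dots> = (\<Prod>i\<in>{u, v}. emeasure M (if i = u then A else B))"
      using uv by (intro PP.emeasure_PiM_Collect) auto
    finally show "emeasure M A * emeasure M B =
        emeasure (distr (\<Pi>\<^sub>M v\<in>V. M) (M \<Otimes>\<^sub>M M) (\<lambda>x. (x u, x v))) (A \<times> B)"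
      using uv by simp
  qed (auto intro: sigma_finite_measure_axioms)
  from subst[where P = "\<lambda>N. AE p in N. P p", OF eq P] show ?thesis
    by (rule AE_distrD[rotated]) simp
qed

context full_prob_space
begin

lemma integral_poly_mult:
  assumes "bmeas M d" "bmeas M g"
  shows "(\<integral>x. poly p (d x) * g x \<partial>M) = (\<Sum>i\<le>degree p. coeff p i * (\<integral>x. d x ^ i * g x \<partial>M))"
  using assms by (simp add: poly_altdef sum_distrib_right mult.assoc integrable_bmeas bmeas_intros)

text \<open>The integrand depends on each coordinate through its degree alone, so the integral can
  be moved to the distribution of the degree. Two such kernels with the same \<open>f\<close>,
  \<open>D\<close>, \<open>r\<close> and the same degree distribution therefore have equal
  densities.\<close>

lemma graph_density_step_fun:
  assumes W: "bkernel M W" and G: "simple_graph V E"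
    and eq: "AE p in M \<Otimes>\<^sub>M M. W (fst p) (snd p) = step_fun f D (\<lambda>a x. poly (r a) (deg W x)) (fst p) (snd p)"
  shows "graph_density V E W = (\<integral>y. (\<Prod>e\<in>E. step_fun f D (\<lambda>a. poly (r a)) (y (Min e)) (y (Max e)))
    \<partial>(\<Pi>\<^sub>M v\<in>V. distr M borel (deg W)))"
proof -
  note ends = edge_ends[OF G]
  have fin: "finite V" and finE: "finite E"
    using G finite_edges by (auto simp: simple_graph_def)
  have [measurable]: "deg W \<in> borel_measurable M"
    using bmeas_deg[OF W] by (rule bmeasD)
  have "graph_density V E W = (\<integral>x. (\<Prod>e\<in>E. step_fun f D (\<lambda>a x. poly (r a) (deg W x)) (x (Min e)) (x (Max e)))
      \<partial>(\<Pi>\<^sub>M v\<in>V. M))"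
    unfolding graph_density_def
  proof (rule integral_cong_AE)
    have "AE x in \<Pi>\<^sub>M v\<in>V. M. \<forall>e\<in>E. W (x (Min e)) (x (Max e)) =
        step_fun f D (\<lambda>a x. poly (r a) (deg W x)) (x (Min e)) (x (Max e))"
    proof (rule AE_finite_allI[OF finE])
      fix e assume e: "e \<in> E"
      from AE_PiM_pair[OF ends[OF e] edge_ends_distinct[OF G e] eq]
      show "AE x in \<Pi>\<^sub>M v\<in>V. M. W (x (Min e)) (x (Max e)) =
          step_fun f D (\<lambda>a x. poly (r a) (deg W x)) (x (Min e)) (x (Max e))"
        by simp
    qed
    then show "AE x in \<Pi>\<^sub>M v\<in>V. M. (\<Prod>e\<in>E. W (x (Min e)) (x (Max e))) =
        (\<Prod>e\<in>E. step_fun f D (\<lambda>a x. poly (r a) (deg W x)) (x (Min e)) (x (Max e)))"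
      by eventually_elim simp
    show "(\<lambda>x. \<Prod>e\<in>E. W (x (Min e)) (x (Max e))) \<in> borel_measurable (\<Pi>\<^sub>M v\<in>V. M)"
      by (intro bmeasD bmeas_prod bkernel_PiM_components[OF W] ends)
    show "(\<lambda>x. \<Prod>e\<in>E. step_fun f D (\<lambda>a x. poly (r a) (deg W x)) (x (Min e)) (x (Max e)))
        \<in> borel_measurable (\<Pi>\<^sub>M v\<in>V. M)"
      by (intro bmeasD bmeas_prod bmeas_step_fun bmeas_poly bmeas_deg[OF W] ends measurable_component_singleton)
  qed
  also have "\<dots> = (\<integral>x. (\<Prod>e\<in>E. step_fun f D (\<lambda>a. poly (r a)) (compose V (deg W) x (Min e)) (compose V (deg W) x (Max e)))
      \<partial>(\<Pi>\<^sub>M v\<in>V. M))"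
    by (intro Bochner_Integration.integral_cong refl prod.cong) (simp add: compose_def ends step_fun_def)
  also have "\<dots> = (\<integral>y. (\<Prod>e\<in>E. step_fun f D (\<lambda>a. poly (r a)) (y (Min e)) (y (Max e)))
    \<partial>distr (\<Pi>\<^sub>M v\<in>V. M) (\<Pi>\<^sub>M v\<in>V. distr M borel (deg W)) (compose V (deg W)))"
  proof (rule integral_distr[symmetric])
    show "compose V (deg W) \<in> measurable (\<Pi>\<^sub>M v\<in>V. M) (\<Pi>\<^sub>M v\<in>V. distr M borel (deg W))"
      unfolding compose_def
      by (rule measurable_restrict, rule measurable_compose[OF measurable_component_singleton]) simp_all
    have poly_component: "(\<lambda>y. poly (r a) (y v)) \<in> borel_measurable (\<Pi>\<^sub>M v\<in>V. distr M borel (deg W))" if "v \<in> V" for a v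
      by (rule measurable_compose[OF measurable_component_singleton[OF that]])
        (simp add: borel_measurable_continuous_onI continuous_on_poly[OF continuous_on_id])
    show "(\<lambda>y. \<Prod>e\<in>E. step_fun f D (\<lambda>a. poly (r a)) (y (Min e)) (y (Max e)))
        \<in> borel_measurable (\<Pi>\<^sub>M v\<in>V. distr M borel (deg W))"
      unfolding step_fun_def
      by (intro borel_measurable_prod borel_measurable_sum borel_measurable_times borel_measurable_const
          poly_component ends)
  qed
  also have "distr (\<Pi>\<^sub>M v\<in>V. M) (\<Pi>\<^sub>M v\<in>V. distr M borel (deg W)) (compose V (deg W)) = (\<Pi>\<^sub>M v\<in>V. distr M borel (deg W))"
  proof -
    have "distr (\<Pi>\<^sub>M v\<in>V. M) (\<Pi>\<^sub>M v\<in>V. distr M borel (deg W)) (compose V (deg W)) =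
        (\<Pi>\<^sub>M v\<in>V. distr M (distr M borel (deg W)) (deg W))"
      by (rule distr_PiM_finite_prob_space') (auto intro: fin prob_space_axioms prob_space_distr)
    also have "distr M (distr M borel (deg W)) (deg W) = distr M borel (deg W)"
      by (rule distr_cong) auto
    finally show ?thesis .
  qed
  finally show ?thesis .
qed

theorem graph_density_eq_of_small:
  assumes D: "finite D" and q: "card D \<ge> 2" and f_sym: "\<And>a b. f a b = f b a"
    and W: "bkernel M W" and W': "bkernel M W'"
    and deg_D: "AE x in M. deg W x \<in> D"
    and W_eq: "AE x in M. AE y in M. W x y = f (deg W x) (deg W y)"
    and small: "\<And>V E. simple_graph V E \<Longrightarrow> card V \<le> 2 * card D + 1 \<Longrightarrow> graph_density V E W' = graph_density V E W"
    and G: "simple_graph V E"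
  shows "graph_density V E W' = graph_density V E W"
proof -
  interpret P: pair_prob_space M M ..
  note d = bmeas_deg[OF W] and d' = bmeas_deg[OF W']
  note leaves = leaf_density_eq[OF W W' small]
  \<comment> \<open>A star with \<open>i\<close> leaves has \<open>i + 1\<close> vertices, so the
    moments up to order \<open>2 * card D\<close> are exactly those within the bound.\<close>
  have moment: "(\<integral>x. deg W' x ^ i \<partial>M) = (\<integral>x. deg W x ^ i \<partial>M)" if "i \<le> 2 * card D" for i
    using leaves[where V = "{0}" and E = "{}" and k = "\<lambda>_. i"] that
    by (simp add: leaf_density_vertex[OF W] leaf_density_vertex[OF W'] simple_graph_def)
  have moment_op: "(\<integral>x. deg W' x ^ i * (\<integral>y. W' x y * deg W' y ^ j \<partial>M) \<partial>M) =
      (\<integral>x. deg W x ^ i * (\<integral>y. W x y * deg W y ^ j \<partial>M) \<partial>M)" if "i < card D" "j < card D" for i j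
    using leaves[where V = "{0, 1}" and E = "{{0, 1}}" and k = "(\<lambda>_. 0)(0 := i, 1 := j)"] that
    unfolding leaf_density_edge[OF W] leaf_density_edge[OF W'] by (simp add: simple_graph_def)
  \<comment> \<open>The path with its leaves has \<open>3 + i + j\<close> vertices. For
    \<open>i\<close> and \<open>j\<close> below \<open>card D\<close> this is at most
    \<open>2 * card D + 1\<close>, which is why the strict bound on the degree of the Lagrange
    polynomials matters.\<close>
  have moment_op2: "(\<integral>x. (\<integral>y. W' x y * deg W' y ^ i \<partial>M) * (\<integral>y. W' x y * deg W' y ^ j \<partial>M) \<partial>M) =
      (\<integral>x. (\<integral>y. W x y * deg W y ^ i \<partial>M) * (\<integral>y. W x y * deg W y ^ j \<partial>M) \<partial>M)" if "i < card D" "j < card D" for i j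
    using leaves[where V = "{0, 1, 2}" and E = "{{0, 1}, {0, 2}}" and k = "(\<lambda>_. 0)(1 := i, 2 := j)"] that
    unfolding leaf_density_path[OF W] leaf_density_path[OF W'] by (simp add: simple_graph_def)
  have "simple_graph {0, 1, 2, 3} {{0, 2}, {1, 2}, {0, 3}, {1, 3}}"
    by (auto simp: simple_graph_def)
  from small[OF this]
  \<comment> \<open>The 4-cycle is within the vertex bound because \<open>card D\<close> is at least
    2.\<close>
  have C4: "(\<integral>x. \<integral>y. (\<integral>z. W' x z * W' z y \<partial>M)\<^sup>2 \<partial>M \<partial>M) = (\<integral>x. \<integral>y. (\<integral>z. W x z * W z y \<partial>M)\<^sup>2 \<partial>M \<partial>M)"
    using q unfolding graph_density_C4[OF W] graph_density_C4[OF W'] by simp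
  have poly1: "(\<integral>x. poly p (deg W' x) \<partial>M) = (\<integral>x. poly p (deg W x) \<partial>M)" if "degree p \<le> 2 * card D" for p
    using integral_poly_mult[OF d bmeas_const, of p 1] integral_poly_mult[OF d' bmeas_const, of p 1] that
    by (simp add: moment)
  have op_expand: "(\<integral>y. U x y * poly p (deg U y) \<partial>M) =
      (\<Sum>i\<le>degree p. coeff p i * (\<integral>y. U x y * deg U y ^ i \<partial>M))" if U: "bkernel M U" for U x p
  proof -
    have "bmeas M (U x)"
      by (rule bkernel_bmeas[OF U]) simp_all
    from integral_poly_mult[OF bmeas_deg[OF U] this, of p] show ?thesis
      by (simp only: mult.commute[of "U x y" for y])
  qed
  have bmeas_op: "bmeas M (\<lambda>x. \<integral>y. U x y * deg U y ^ i \<partial>M)" if U: "bkernel M U" for U i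
    by (intro bmeas_integral bmeas_intros bmeas_comp[OF bmeas_deg[OF U]] bkernel_bmeas[OF U]; measurable)
  define e where "e U a x = poly (lagrange D a) (deg U x)" for U a x
  have degree: "degree (lagrange D a) < card D" if "a \<in> D" for a
    using that D by (rule degree_lagrange[rotated])
  have step_eval: "step_fun f D (e U) x y = f (deg U x) (deg U y)" if "deg U x \<in> D" "deg U y \<in> D" for U x y
    unfolding step_fun_def e_def using that D
    by (simp add: poly_lagrange if_distrib[of "\<lambda>t. _ * t"] sum.delta' cong: if_cong)
  have W_step: "AE x in M. AE y in M. W x y = step_fun f D (e W) x y"
    using W_eq deg_D
  proof eventually_elim
    case (elim x)
    note x = elim(2)
    show ?case
      using elim(1) deg_D by eventually_elim (simp add: step_eval x)
  qed
  have step': "AE p in M \<Otimes>\<^sub>M M. W' (fst p) (snd p) = step_fun f D (e W') (fst p) (snd p)"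
  proof (rule kernel_eq_step_fun[OF D f_sym W W' _ _ W_step _ _ _ C4])
    fix a b assume ab: "a \<in> D" "b \<in> D"
    show "bmeas M (e W a)" "bmeas M (e W' a)"
      unfolding e_def by (intro bmeas_poly d d')+
    have "degree (lagrange D a * lagrange D b) \<le> 2 * card D"
      using degree_mult_le[of "lagrange D a" "lagrange D b"] degree[OF ab(1)] degree[OF ab(2)] by simp
    from poly1[OF this] show "(\<integral>x. e W' a x * e W' b x \<partial>M) = (\<integral>x. e W a x * e W b x \<partial>M)"
      by (simp add: e_def)
    \<comment> \<open>Expanding both Lagrange polynomials into powers of the degree reduces the
      claim to \<open>moment_op\<close>, and the squared norm further below to
      \<open>moment_op2\<close> in the same way.\<close>
    have "(\<integral>x. e U a x * (\<integral>y. U x y * e U b y \<partial>M) \<partial>M) =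
      (\<Sum>i\<le>degree (lagrange D a). coeff (lagrange D a) i * (\<Sum>j\<le>degree (lagrange D b). coeff (lagrange D b) j *
        (\<integral>x. deg U x ^ i * (\<integral>y. U x y * deg U y ^ j \<partial>M) \<partial>M)))" if U: "bkernel M U" for U
      unfolding e_def op_expand[OF U]
      by (simp add: integral_poly_mult bmeas_deg[OF U] bmeas_intros bmeas_op[OF U] sum_distrib_left
            integrable_bmeas mult.left_commute[of "deg U _ ^ _"]) (rule sum.swap)
    note expand = this
    show "(\<integral>x. e W' a x * (\<integral>y. W' x y * e W' b y \<partial>M) \<partial>M) = (\<integral>x. e W a x * (\<integral>y. W x y * e W b y \<partial>M) \<partial>M)"
      unfolding expand[OF W] expand[OF W'] using degree[OF ab(1)] degree[OF ab(2)]
      by (intro sum.cong refl arg_cong[where f = "(*) _"] moment_op) auto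
  next
    fix b assume b: "b \<in> D"
    have "(\<integral>x. (\<integral>y. U x y * e U b y \<partial>M)\<^sup>2 \<partial>M) =
      (\<Sum>i\<le>degree (lagrange D b). \<Sum>j\<le>degree (lagrange D b). coeff (lagrange D b) i * coeff (lagrange D b) j *
        (\<integral>x. (\<integral>y. U x y * deg U y ^ i \<partial>M) * (\<integral>y. U x y * deg U y ^ j \<partial>M) \<partial>M))" if U: "bkernel M U" for U
    proof -
      have "(\<integral>x. (\<integral>y. U x y * e U b y \<partial>M)\<^sup>2 \<partial>M) =
        (\<integral>x. (\<Sum>i\<le>degree (lagrange D b). \<Sum>j\<le>degree (lagrange D b). coeff (lagrange D b) i * coeff (lagrange D b) j *
        ((\<integral>y. U x y * deg U y ^ i \<partial>M) * (\<integral>y. U x y * deg U y ^ j \<partial>M))) \<partial>M)"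
        unfolding e_def op_expand[OF U] power2_eq_square sum_product by (simp only: mult_ac)
      then show ?thesis
        by (simp add: integrable_bmeas bmeas_intros bmeas_op[OF U])
    qed
    note expand = this
    show "(\<integral>x. (\<integral>y. W' x y * e W' b y \<partial>M)\<^sup>2 \<partial>M) = (\<integral>x. (\<integral>y. W x y * e W b y \<partial>M)\<^sup>2 \<partial>M)"
      unfolding expand[OF W] expand[OF W'] using degree[OF b]
      by (intro sum.cong refl arg_cong[where f = "(*) _"] moment_op2) auto
  qed
  have step: "AE p in M \<Otimes>\<^sub>M M. W (fst p) (snd p) = step_fun f D (e W) (fst p) (snd p)"
  proof (rule P.AE_pair_measure)
    show "{p \<in> space (M \<Otimes>\<^sub>M M). W (fst p) (snd p) = step_fun f D (e W) (fst p) (snd p)} \<in> sets (M \<Otimes>\<^sub>M M)"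
      unfolding e_def
      by (intro borel_measurable_eq bmeasD[OF bkernel_bmeas[OF W]] bmeasD[OF bmeas_step_fun] bmeas_poly d; measurable)
    show "AE x in M. AE y in M. W (fst (x, y)) (snd (x, y)) = step_fun f D (e W) (fst (x, y)) (snd (x, y))"
      using W_step by simp
  qed
  have deg'_D: "AE x in M. deg W' x \<in> D"
  proof -
    define p where "p = (\<Prod>c\<in>D. [:- c, 1:]\<^sup>2)"
    have "degree p \<le> (\<Sum>c\<in>D. degree ([:- c, 1:]\<^sup>2))"
      unfolding p_def using degree_prod_sum_le[OF D, of "\<lambda>c. [:- c, 1:]\<^sup>2"] by (simp add: comp_def)
    also have "\<dots> = 2 * card D"
      by (simp add: degree_power_eq)
    finally have "(\<integral>x. poly p (deg W' x) \<partial>M) = (\<integral>x. poly p (deg W x) \<partial>M)"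
      by (rule poly1)
    also have p_zero: "poly p t = 0 \<longleftrightarrow> t \<in> D" for t
      using D by (auto simp: p_def poly_prod)
    then have "(\<integral>x. poly p (deg W x) \<partial>M) = 0"
      using deg_D by (intro integral_eq_zero_AE) (auto elim: eventually_mono)
    finally have "(\<integral>x. poly p (deg W' x) \<partial>M) = 0" .
    moreover have "poly p t \<ge> 0" for t
      by (auto simp: p_def poly_prod intro: prod_nonneg)
    ultimately have "AE x in M. poly p (deg W' x) = 0"
      by (subst (asm) integral_nonneg_eq_0_iff_AE) (auto intro!: integrable_bmeas bmeas_poly d')
    then show ?thesis
      by (simp add: p_zero)
  qed
  have [measurable]: "deg W \<in> borel_measurable M" "deg W' \<in> borel_measurable M"
    using d d' by (simp_all add: bmeasD)
  have "distr M borel (deg W') = distr M borel (deg W)"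
  proof (rule measure_eqI)
    fix A assume "A \<in> sets (distr M borel (deg W'))"
    then have A [measurable]: "A \<in> sets borel"
      by simp
    \<comment> \<open>On \<open>D\<close> this polynomial is the indicator function of
      \<open>A\<close>. As both degrees lie in \<open>D\<close> almost surely, the probability of
      \<open>A\<close> is the integral of \<open>p\<close>, which \<open>poly1\<close> shows to be
      the same for both kernels.\<close>
    define p where "p = (\<Sum>a\<in>D \<inter> A. lagrange D a)"
    have "degree p \<le> 2 * card D"
      unfolding p_def
    proof (intro degree_sum_le)
      show "degree (lagrange D a) \<le> 2 * card D" if "a \<in> D \<inter> A" for a
        using degree[of a] that by auto
    qed (use D in auto)
    have poly_p: "poly p t = indicator A t" if "t \<in> D" for t
    proof -
      have "poly p t = (\<Sum>a\<in>D \<inter> A. if t = a then 1 else 0)"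
        unfolding p_def poly_sum using that D by (intro sum.cong refl) (simp add: poly_lagrange)
      then show ?thesis
        using that D by (simp add: indicator_def)
    qed
    have "emeasure (distr M borel (deg U)) A = ennreal (\<integral>x. poly p (deg U x) \<partial>M)"
      if U: "bmeas M (deg U)" and ae: "AE x in M. deg U x \<in> D" for U
    proof -
      have [measurable]: "deg U \<in> borel_measurable M"
        using U by (rule bmeasD)
      have [measurable]: "deg U -` A \<in> sets M"
        using measurable_sets[of "deg U" M borel A] by simp
      have "emeasure (distr M borel (deg U)) A = ennreal (measure M (deg U -` A))"
        by (simp add: emeasure_distr emeasure_eq_measure)
      also have "measure M (deg U -` A) = (\<integral>x. indicator (deg U -` A) x \<partial>M)"
        by simp
      also have "\<dots> = (\<integral>x. poly p (deg U x) \<partial>M)"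
      proof (rule integral_cong_AE)
        show "AE x in M. indicator (deg U -` A) x = poly p (deg U x)"
          using ae by eventually_elim (simp add: poly_p indicator_def)
      qed (simp_all add: bmeasD[OF bmeas_poly[OF U]])
      finally show ?thesis .
    qed
    from this[OF d deg_D] this[OF d' deg'_D]
    show "emeasure (distr M borel (deg W')) A = emeasure (distr M borel (deg W)) A"
      using poly1[OF \<open>degree p \<le> 2 * card D\<close>] by simp
  qed simp
  then show ?thesis
    using graph_density_step_fun[OF W G step[unfolded e_def[abs_def]]]
      graph_density_step_fun[OF W' G step'[unfolded e_def[abs_def]]]
    by (simp only:)
qed

end

section \<open>Lebesgue kernels on the unit square and Borel representatives\<close>

text \<open>A function that agrees almost everywhere with a measurable one is measurable for the
  completion, and its integral can be computed from the representative.\<close>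

lemma integral_completion_AE:
  fixes f g :: "'a \<Rightarrow> real"
  assumes g: "g \<in> borel_measurable N" and ae: "AE x in N. f x = g x"
  shows "integral\<^sup>L (completion N) f = integral\<^sup>L N g"
proof -
  have ae': "AE x in completion N. f x = g x"
    using ae by (rule AE_completion)
  have g': "g \<in> borel_measurable (completion N)"
    using g by (rule measurable_completion)
  have "f \<in> borel_measurable (completion N)"
  proof (rule measurableI)
    fix A :: "real set" assume "A \<in> sets borel"
    then have "g -` A \<inter> space (completion N) \<in> sets (completion N)"
      by (rule measurable_sets[OF g'])
    then show "f -` A \<inter> space (completion N) \<in> sets (completion N)"
    proof (rule completion.in_sets_AE[rotated])
      show "AE x in completion N. (x \<in> g -` A \<inter> space (completion N)) = (x \<in> f -` A \<inter> space (completion N))"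
        using ae' by eventually_elim simp
    qed simp
  qed simp
  then have "integral\<^sup>L (completion N) f = integral\<^sup>L (completion N) g"
    using g' ae' by (rule integral_cong_AE)
  then show ?thesis
    by (simp only: integral_completion[OF g])
qed

abbreviation unit_restrict :: "real measure" where
  "unit_restrict \<equiv> restrict_space lborel {0..1}"

text \<open>Lebesgue measure on the unit interval, but carried by the whole real line, as
  \<open>full_prob_space\<close> demands. The factors in \<open>hom_density\<close> are
  \<open>unit_restrict\<close>, whose space is the interval itself.\<close>

definition unit_measure :: "real measure" where
  "unit_measure = uniform_measure lborel {0..1}"

lemma AE_unit_measure: "(AE x in unit_measure. P x) \<longleftrightarrow> (AE x in lborel. x \<in> {0..1} \<longrightarrow> P x)"
  unfolding unit_measure_def by (subst AE_uniform_measure) auto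

lemma AE_unit_restrict: "(AE x in unit_restrict. P x) \<longleftrightarrow> (AE x in lborel. x \<in> {0..1} \<longrightarrow> P x)"
  by (rule AE_restrict_space_iff) simp

lemma sets_unit_measure [simp, measurable_cong]: "sets unit_measure = sets borel"
  by (simp add: unit_measure_def)

lemma full_prob_space_unit_measure: "full_prob_space unit_measure"
proof -
  have "prob_space unit_measure"
    unfolding unit_measure_def by (rule prob_space_uniform_measure) simp_all
  then show ?thesis
    by (simp add: full_prob_space_def full_prob_space_axioms_def unit_measure_def)
qed

interpretation unit: full_prob_space unit_measure
  by (rule full_prob_space_unit_measure)

interpretation restr: prob_space unit_restrict
  by (rule prob_spaceI) (simp add: emeasure_restrict_space space_restrict_space)

lemma measurable_unit_restrict [measurable]: "(\<lambda>x. x) \<in> measurable unit_restrict unit_measure"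
  by (simp add: measurable_restrict_space1 cong: measurable_cong_sets)

lemma distr_unit_restrict: "distr unit_restrict unit_measure (\<lambda>x. x) = unit_measure"
proof (rule measure_eqI)
  fix A assume "A \<in> sets (distr unit_restrict unit_measure (\<lambda>x. x))"
  then have A [measurable]: "A \<in> sets borel"
    by simp
  have "emeasure (distr unit_restrict unit_measure (\<lambda>x. x)) A = emeasure unit_restrict (A \<inter> {0..1})"
    by (subst emeasure_distr) (simp_all add: space_restrict_space)
  also have "\<dots> = emeasure lborel (A \<inter> {0..1})"
    by (rule emeasure_restrict_space) auto
  finally show "emeasure (distr unit_restrict unit_measure (\<lambda>x. x)) A = emeasure unit_measure A"
    by (simp only: unit_measure_def) (simp add: Int_commute divide_ennreal_def)
qed simp

text \<open>Extended by 0, a Lebesgue measurable function has a Borel representative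
  \<open>g\<close>. Averaging \<open>g\<close> with its transpose gives symmetry at every point,
  truncation at a bound of \<open>U\<close> gives boundedness at every point, and neither changes
  the values at almost every point of the square.\<close>

lemma real_kernel_ex_bkernel:
  assumes "real_kernel U"
  obtains W where "bkernel unit_measure W"
    "AE p in lborel. p \<in> {0..1} \<times> {0..1} \<longrightarrow> U (fst p) (snd p) = W (fst p) (snd p)"
proof -
  let ?S = "{0..1} \<times> {0..1} :: (real \<times> real) set"
  have "(\<lambda>(x, y). U x y) \<in> borel_measurable (lebesgue_on ?S)"
    and bdd: "bounded ((\<lambda>(x, y). U x y) ` ?S)"
    and sym: "\<And>x y. x \<in> {0..1} \<Longrightarrow> y \<in> {0..1} \<Longrightarrow> U x y = U y x"
    using assms unfolding real_kernel_def by auto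
  have S: "?S \<in> sets lebesgue"
    by (simp add: borel_Times)
  with \<open>(\<lambda>(x, y). U x y) \<in> _\<close> have "(\<lambda>p. indicator ?S p *\<^sub>R (case p of (x, y) \<Rightarrow> U x y)) \<in> borel_measurable lebesgue"
    by (subst (asm) borel_measurable_restrict_space_iff) auto
  from completion_ex_borel_measurable_real[OF this]
  obtain g where g [measurable]: "g \<in> borel_measurable lborel"
    and ae: "AE p in lborel. indicator ?S p *\<^sub>R (case p of (x, y) \<Rightarrow> U x y) = g p"
    by blast
  have [measurable]: "g \<in> borel_measurable borel"
    using g by simp
  obtain B where B: "\<And>x y. x \<in> {0..1} \<Longrightarrow> y \<in> {0..1} \<Longrightarrow> \<bar>U x y\<bar> \<le> B"
    using bdd unfolding bounded_iff by force
  define W where "W x y = max (- B) (min B ((g (x, y) + g (y, x)) / 2))" for x y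
  have "bkernel unit_measure W"
  proof -
    have sets: "sets (unit_measure \<Otimes>\<^sub>M unit_measure) = sets (borel :: (real \<times> real) measure)"
      by (simp add: borel_prod[symmetric] cong: sets_pair_measure_cong)
    have "(\<lambda>q. W (fst q) (snd q)) \<in> borel_measurable borel"
    proof -
      have "(\<lambda>q. (snd q, fst q)) \<in> measurable (borel :: (real \<times> real) measure) borel"
        by (intro borel_measurable_continuous_onI continuous_intros)
      then have [measurable]: "(\<lambda>q. g (snd q, fst q)) \<in> borel_measurable borel"
        by (rule measurable_compose) fact
      show ?thesis
        unfolding W_def prod.collapse
        by (intro borel_measurable_max borel_measurable_min borel_measurable_const borel_measurable_divide
            borel_measurable_add) measurable
    qed
    then have "(\<lambda>q. W (fst q) (snd q)) \<in> borel_measurable (unit_measure \<Otimes>\<^sub>M unit_measure)"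
      by (simp add: measurable_cong_sets[OF sets refl])
    moreover have "\<bar>W x y\<bar> \<le> \<bar>B\<bar>" for x y
      unfolding W_def by (auto simp: max_def min_def)
    ultimately show ?thesis
      unfolding bkernel_def bmeas_def by (auto simp: W_def add.commute)
  qed
  moreover have "AE p in lborel. p \<in> ?S \<longrightarrow> U (fst p) (snd p) = W (fst p) (snd p)"
  proof -
    \<comment> \<open>Exchanging the coordinates preserves Lebesgue measure of the plane, so almost
      everywhere the transpose of \<open>g\<close> agrees with that of \<open>U\<close> as
      well.\<close>
    have swap: "lborel = distr (lborel :: (real \<times> real) measure) lborel (\<lambda>(x, y). (y, x))"
      using lborel_pair.distr_pair_swap by (simp add: lborel_prod)
    from subst[where P = "\<lambda>N. AE p in N. indicator ?S p *\<^sub>R (case p of (x, y) \<Rightarrow> U x y) = g p", OF swap ae]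
    have "AE p in lborel. indicator ?S (case p of (x, y) \<Rightarrow> (y, x)) *\<^sub>R (case (case p of (x, y) \<Rightarrow> (y, x)) of (x, y) \<Rightarrow> U x y) = g (case p of (x, y) \<Rightarrow> (y, x))"
      by (rule AE_distrD[rotated])
        (simp add: case_prod_beta' borel_measurable_continuous_onI continuous_on_Pair continuous_on_fst continuous_on_snd)
    with ae show ?thesis
    proof eventually_elim
      case (elim p)
      show ?case
      proof
        assume p: "p \<in> ?S"
        obtain x y where xy: "p = (x, y)"
          by (cases p)
        with p elim have "g (x, y) = U x y" "g (y, x) = U x y"
          using sym[of x y] by auto
        then show "U (fst p) (snd p) = W (fst p) (snd p)"
          using B[of x y] p unfolding W_def xy by auto
      qed
    qed
  qed
  ultimately show thesis
    using that by blast
qed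

lemma AE_unit_square:
  assumes "AE p in lborel. p \<in> {0..1} \<times> {0..1} \<longrightarrow> P p"
  shows "AE x in unit_measure. AE y in unit_measure. P (x, y)"
    and "AE p in unit_restrict \<Otimes>\<^sub>M unit_restrict. P p"
proof -
  have "AE p in lborel \<Otimes>\<^sub>M (lborel :: real measure). p \<in> {0..1} \<times> {0..1} \<longrightarrow> P p"
    using assms unfolding lborel_prod .
  \<comment> \<open>\<open>P\<close> is not assumed to be measurable, so the exceptional points are
    first enclosed in a measurable null set \<open>N\<close>, to which Fubini applies.\<close>
  then obtain N where N: "\<And>p. p \<notin> N \<Longrightarrow> p \<in> {0..1} \<times> {0..1} \<longrightarrow> P p" "N \<in> null_sets (lborel \<Otimes>\<^sub>M (lborel :: real measure))"
    by (rule AE_E3) (auto simp: space_pair_measure)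
  have ae: "AE x in lborel. AE y in lborel. (x, y) \<notin> N"
    using lborel_pair.AE_pair[OF AE_not_in[OF N(2)]] .
  have "AE x in lborel. x \<in> {0..1} \<longrightarrow> (AE y in lborel. y \<in> {0..1} \<longrightarrow> P (x, y))"
    using ae
  proof eventually_elim
    case (elim x)
    then show ?case
      using N(1) by (auto elim: eventually_mono)
  qed
  then show "AE x in unit_measure. AE y in unit_measure. P (x, y)"
    by (simp add: AE_unit_measure)
  interpret R: pair_prob_space unit_restrict unit_restrict ..
  have [measurable]: "N \<in> sets (borel \<Otimes>\<^sub>M borel)"
    using N(2) by (simp add: null_sets_def cong: sets_pair_measure_cong)
  have "AE p in unit_restrict \<Otimes>\<^sub>M unit_restrict. p \<notin> N"
  proof (rule R.AE_pair_measure)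
    have [measurable]: "fst \<in> borel_measurable (unit_restrict \<Otimes>\<^sub>M unit_restrict)" 
      "snd \<in> borel_measurable (unit_restrict \<Otimes>\<^sub>M unit_restrict)"
      using measurable_compose[OF measurable_fst[of unit_restrict unit_restrict], of id borel]
       measurable_compose[OF measurable_snd[of unit_restrict unit_restrict], of id borel]
      by (simp_all add: measurable_restrict_space1)
    have "(\<lambda>p. (fst p, snd p)) \<in> measurable (unit_restrict \<Otimes>\<^sub>M unit_restrict) (borel \<Otimes>\<^sub>M borel)"
      by measurable
    then show "{p \<in> space (unit_restrict \<Otimes>\<^sub>M unit_restrict). p \<notin> N} \<in> sets (unit_restrict \<Otimes>\<^sub>M unit_restrict)"
      by simp measurable
    have "AE x in lborel. x \<in> {0..1} \<longrightarrow> (AE y in lborel. y \<in> {0..1} \<longrightarrow> (x, y) \<notin> N)"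
      using ae by eventually_elim (auto elim: eventually_mono)
    then show "AE x in unit_restrict. AE y in unit_restrict. (x, y) \<notin> N"
      by (simp only: AE_unit_restrict)
  qed
  then show "AE p in unit_restrict \<Otimes>\<^sub>M unit_restrict. P p"
    by (rule AE_mp) (use N(1) in \<open>auto intro!: AE_I2 simp: space_pair_measure space_restrict_space\<close>)
qed


text \<open>The ends of an edge are distinct coordinates, so at almost every point of the cube
  \<open>U\<close> and \<open>W\<close> agree along all of the finitely many edges. The inclusion of
  the interval into the real line then carries one product measure to the other.\<close>

lemma hom_density_eq_graph_density:
  assumes W: "bkernel unit_measure W" and G: "simple_graph V E"
    and ae: "AE p in lborel. p \<in> {0..1} \<times> {0..1} \<longrightarrow> U (fst p) (snd p) = W (fst p) (snd p)"
  shows "hom_density V E U = unit.graph_density V E W"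
proof -
  note ends = edge_ends[OF G]
  have fin: "finite V" and finE: "finite E"
    using G finite_edges by (auto simp: simple_graph_def)
  let ?F = "\<lambda>x. \<Prod>e\<in>E. W (x (Min e)) (x (Max e))"
  have F: "?F \<in> borel_measurable (\<Pi>\<^sub>M v\<in>V. unit_measure)"
    by (intro bmeasD bmeas_prod unit.bkernel_PiM_components[OF W] ends)
  \<comment> \<open>On functions with domain \<open>V\<close>,
    \<open>compose V (\<lambda>x. x)\<close> is the inclusion of the cube into the real space with
    coordinates \<open>V\<close>.\<close>
  have comp: "compose V (\<lambda>x. x) \<in> measurable (\<Pi>\<^sub>M v\<in>V. unit_restrict) (\<Pi>\<^sub>M v\<in>V. unit_measure)"
    unfolding compose_def
    by (rule measurable_restrict, rule measurable_compose[OF measurable_component_singleton])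
      (auto intro: measurable_unit_restrict)
  have comp_F: "?F (compose V (\<lambda>x. x) x) = ?F x" for x
    using ends by (intro prod.cong refl) (simp add: compose_def)
  have "AE x in \<Pi>\<^sub>M v\<in>V. unit_restrict. \<forall>e\<in>E. U (x (Min e)) (x (Max e)) = W (x (Min e)) (x (Max e))"
  proof (rule AE_finite_allI[OF finE])
    fix e assume e: "e \<in> E"
    show "AE x in \<Pi>\<^sub>M v\<in>V. unit_restrict. U (x (Min e)) (x (Max e)) = W (x (Min e)) (x (Max e))"
      using restr.AE_PiM_pair[OF ends[OF e] edge_ends_distinct[OF G e] AE_unit_square(2)[OF ae]] by simp
  qed
  then have "AE x in \<Pi>\<^sub>M v\<in>V. unit_restrict. (\<Prod>e\<in>E. U (x (Min e)) (x (Max e))) = ?F x"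
    by eventually_elim simp
  moreover have "?F \<in> borel_measurable (\<Pi>\<^sub>M v\<in>V. unit_restrict)"
    using measurable_compose[OF comp F] by (simp only: comp_F)
  ultimately have "hom_density V E U = (\<integral>x. ?F x \<partial>(\<Pi>\<^sub>M v\<in>V. unit_restrict))"
    unfolding hom_density_def by (intro integral_completion_AE)
  also have "\<dots> = (\<integral>x. ?F (compose V (\<lambda>x. x) x) \<partial>(\<Pi>\<^sub>M v\<in>V. unit_restrict))"
    by (simp only: comp_F)
  also have "\<dots> = (\<integral>x. ?F x \<partial>distr (\<Pi>\<^sub>M v\<in>V. unit_restrict) (\<Pi>\<^sub>M v\<in>V. unit_measure) (compose V (\<lambda>x. x)))"
    by (rule integral_distr[OF comp F, symmetric])
  also have "distr (\<Pi>\<^sub>M v\<in>V. unit_restrict) (\<Pi>\<^sub>M v\<in>V. unit_measure) (compose V (\<lambda>x. x)) =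
      (\<Pi>\<^sub>M v\<in>V. distr unit_restrict unit_measure (\<lambda>x. x))"
    by (rule distr_PiM_finite_prob_space'[OF fin restr.prob_space_axioms unit.prob_space_axioms measurable_unit_restrict])
  finally show ?thesis
    by (simp only: distr_unit_restrict unit.graph_density_def)
qed

lemma vertex_degree_AE_eq_deg:
  assumes W: "bkernel unit_measure W"
    and ae: "AE p in lborel. p \<in> {0..1} \<times> {0..1} \<longrightarrow> U (fst p) (snd p) = W (fst p) (snd p)"
  shows "AE x in unit_measure. vertex_degree U x = unit.deg W x"
  using AE_unit_square(1)[OF ae]
proof eventually_elim
  case (elim x)
  have "bmeas unit_measure (W x)"
    by (rule bkernel_bmeas[OF W]) simp_all
  from bmeasD[OF this] have Wx [measurable]: "W x \<in> borel_measurable borel"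
    by (simp cong: measurable_cong_sets)
  have "vertex_degree U x = (\<integral>y. indicator {0..1} y *\<^sub>R U x y \<partial>lebesgue)"
    unfolding vertex_degree_def by (rule integral_restrict_space) simp
  also have "\<dots> = (\<integral>y. indicator {0..1} y *\<^sub>R W x y \<partial>lborel)"
  proof (rule integral_completion_AE)
    show "AE y in lborel. indicator {0..1} y *\<^sub>R U x y = indicator {0..1} y *\<^sub>R W x y"
      using elim unfolding AE_unit_measure by eventually_elim (auto simp: indicator_def)
  qed simp
  also have "\<dots> = (\<integral>y. W x y \<partial>unit_restrict)"
    by (rule integral_restrict_space[symmetric]) simp
  also have "\<dots> = (\<integral>y. W x y \<partial>distr unit_restrict unit_measure (\<lambda>x. x))"
    by (rule integral_distr[symmetric, OF measurable_unit_restrict]) (simp cong: measurable_cong_sets)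
  finally show ?case
    by (simp only: distr_unit_restrict unit.deg_def)
qed

section \<open>The theorem for step kernels on the unit square\<close>

theorem theorem11:
  fixes q :: nat
    and U U' :: "real \<Rightarrow> real \<Rightarrow> real"
    and P :: "real set set"
  assumes "q \<ge> 2"
    and "step_kernel q U"
    and "step_partition U P" and "card P = q"
    and "\<And>A B x y. A \<in> P \<Longrightarrow> B \<in> P \<Longrightarrow> A \<noteq> B \<Longrightarrow> x \<in> A \<Longrightarrow> y \<in> B \<Longrightarrow> vertex_degree U x \<noteq> vertex_degree U y"
    and "real_kernel U'"
    and "\<And>V E. simple_graph V E \<Longrightarrow> card V \<le> 2 * q + 1 \<Longrightarrow>
           hom_density V E U' = hom_density V E U"
  shows "weakly_isomorphic U U'"
proof -
  have "real_kernel U"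
    using assms(2) by (simp add: step_kernel_def)
  then obtain W where W: "bkernel unit_measure W"
    and U_W: "AE p in lborel. p \<in> {0..1} \<times> {0..1} \<longrightarrow> U (fst p) (snd p) = W (fst p) (snd p)"
    by (rule real_kernel_ex_bkernel)
  obtain W' where W': "bkernel unit_measure W'"
    and U_W': "AE p in lborel. p \<in> {0..1} \<times> {0..1} \<longrightarrow> U' (fst p) (snd p) = W' (fst p) (snd p)"
    using real_kernel_ex_bkernel[OF assms(6)] by blast
  note densities = hom_density_eq_graph_density[OF W _ U_W] hom_density_eq_graph_density[OF W' _ U_W']
  have finP: "finite P" and partP: "partition_on {0..1} P"
    and const: "\<And>A B. A \<in> P \<Longrightarrow> B \<in> P \<Longrightarrow> \<exists>c. \<forall>x\<in>A. \<forall>y\<in>B. U x y = c"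
    using assms(3) unfolding step_partition_def by blast+
  define rep where "rep A = (SOME x. x \<in> A)" for A :: "real set"
  have rep: "rep A \<in> A" if "A \<in> P" for A
  proof -
    have "A \<noteq> {}"
      using partition_onD3[OF partP] that by blast
    then show ?thesis
      by (simp add: rep_def some_in_eq)
  qed
  have rep_unit: "rep A \<in> {0..1}" if "A \<in> P" for A
    using partition_onD1[OF partP] rep[OF that] that by blast
  have part_ex: "\<exists>A\<in>P. x \<in> A" if "x \<in> {0..1}" for x
    using partition_onD1[OF partP] that by blast
  \<comment> \<open>Each part is labelled by the common degree of its points. Different parts have
    different degrees, so the labelling is injective and the set \<open>D\<close> of labels has
    \<open>q\<close> elements.\<close>
  define part_deg where "part_deg A = vertex_degree U (rep A)" for A
  define D where "D = part_deg ` P"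
  have inj: "inj_on part_deg P"
    unfolding part_deg_def using assms(5) rep by (meson inj_onI)
  have finD: "finite D" and card_D: "card D = q"
    unfolding D_def using finP assms(4) by (simp_all add: card_image[OF inj])
  define f where "f s t = (if s \<in> D \<and> t \<in> D
    then U (rep (the_inv_into P part_deg s)) (rep (the_inv_into P part_deg t)) else 0)" for s t
  have inv: "the_inv_into P part_deg s \<in> P" if "s \<in> D" for s
    using that the_inv_into_into[OF inj] unfolding D_def by blast
  have f_sym: "f s t = f t s" for s t
    using \<open>real_kernel U\<close> rep_unit inv unfolding f_def real_kernel_def by auto
  have vdeg: "vertex_degree U x = part_deg A" if x: "x \<in> A" and A: "A \<in> P" for x A
    unfolding part_deg_def vertex_degree_def
  proof (rule Bochner_Integration.integral_cong[OF refl])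
    fix y assume "y \<in> space (lebesgue_on {0..1::real})"
    then obtain B where "B \<in> P" "y \<in> B"
      using part_ex[of y] by (auto simp: space_restrict_space)
    with const[OF A] x rep[OF A] show "U x y = U (rep A) y"
      by metis
  qed
  have U_f: "U x y = f (vertex_degree U x) (vertex_degree U y)" "vertex_degree U x \<in> D"
    if xy: "x \<in> {0..1}" "y \<in> {0..1}" for x y
  proof -
    obtain A B where AB: "A \<in> P" "x \<in> A" "B \<in> P" "y \<in> B"
      using part_ex xy by meson
    then have "U x y = U (rep A) (rep B)"
      using const[of A B] rep by metis
    with AB show "U x y = f (vertex_degree U x) (vertex_degree U y)" "vertex_degree U x \<in> D"
      by (simp_all add: vdeg f_def D_def the_inv_into_f_f[OF inj])
  qed
  have unit_AE: "AE x in unit_measure. x \<in> {0..1}"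
    by (simp add: AE_unit_measure)
  note degW = vertex_degree_AE_eq_deg[OF W U_W]
  have deg_D: "AE x in unit_measure. unit.deg W x \<in> D"
    using degW unit_AE by eventually_elim (metis U_f(2))
  have W_f: "AE x in unit_measure. AE y in unit_measure. W x y = f (unit.deg W x) (unit.deg W y)"
    using AE_unit_square(1)[OF U_W] degW unit_AE
  proof eventually_elim
    case (elim x)
    note x = elim(2,3)
    show ?case
      using elim(1) degW unit_AE by eventually_elim (use x U_f(1)[of x] in auto)
  qed
  have small: "unit.graph_density V E W' = unit.graph_density V E W"
    if "simple_graph V E" "card V \<le> 2 * card D + 1" for V E
    using assms(7)[of V E] that densities[of V E] by (simp add: card_D)
  have "unit.graph_density V E W' = unit.graph_density V E W" if "simple_graph V E" for V E
    by (rule unit.graph_density_eq_of_small[where f = f, OF finD _ f_sym W W' deg_D W_f small that])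
      (use assms(1) card_D in simp_all)
  then show ?thesis
    unfolding weakly_isomorphic_def using densities by simp
qed

end
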